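(* Let $f=(f_1,\dots,f_s):\mathbb{R}^n\to\mathbb{R}^s$ be a locally Lipschitz mapping and let $K\subseteq\mathbb{R}^n$ be a nonempty closed set. Assume that $f$ is weakly section-bounded from below on $K$ with respect to the nonempty index set $I\subseteq\{1,\dots,s\}$ and $x_0\in K$. Then the following assertions are equivalent: (i) $f|_K$ is proper with respect to $I$ at the sublevel $f(x_0)$. (ii) $f|_K$ satisfies the Palais-Smale condition with respect to $I$ at the sublevel $f(x_0)$. (iii) $f|_K$ satisfies the weak Palais-Smale condition with respect to $I$ at the sublevel $f(x_0)$. (iv) $f|_K$ satisfies the M-tame condition with respect to $I$ at the sublevel $f(x_0)$. Moreover, the set $\{x\in K: f(x)\le f(x_0)\}$ and the section $[f(K)]_{f(x_0)}=f(K)\cap(f(x_0)-\mathbb{R}^s_+)$ are compact if any of the conditions (i)-(iv) is fulfilled.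
   Context: Inequalities between vectors are componentwise. For $I=\{s_1<\dots<s_q\}\subseteq\{1,\dots,s\}$ nonempty, $|I|=q$, put $f_I=(f_{s_1},\dots,f_{s_q})$. For $x_0\in K$ put $K_{x_0}=\{x\in K: f_i(x)\le f_i(x_0),\ i=1,\dots,s\}$. Weak section-boundedness: $f$ is weakly section-bounded from below on $K$ with respect to $I$ and $x_0$ if there is $\bar a\in\mathbb{R}^{|I|}$ with $\{f_I(x): x\in K_{x_0}\}\subseteq \bar a+\mathbb{R}^{|I|}_+$. Properness: $f|_K$ is proper with respect to $I$ at the sublevel $y_0\in\mathbb{R}^s$ if for every sequence $\{x_k\}\subseteq K$ with $\|x_k\|\to+\infty$ and $f(x_k)\le y_0$ for all $k$, one has $\|f_I(x_k)\|\to+\infty$. Normal cones and subdifferentials: for $C\subseteq\mathbb{R}^m$ and $\bar x\in C$, the regular normal cone $\hat N(\bar x;C)$ is the set of $v$ with $\langle v,x-\bar x\rangle\le o(\|x-\bar x\|)$ for $x\in C$, $x\to\bar x$; the limiting normal cone $N(\bar x;C)$ is the set of all limits $v=\lim v_k$ with $v_k\in\hat N(x_k;C)$, $x_k\in C$, $x_k\to\bar x$. For $\varphi:\mathbb{R}^n\to\mathbb{R}$, the (limiting) subdifferential is $\partial\varphi(\bar x)=\{v: (v,-1)\in N((\bar x,\varphi(\bar x));\mathrm{epi}\,\varphi)\}$, where $\mathrm{epi}\,\varphi=\{(x,y):\varphi(x)\le y\}$. Extended Rabier function (for $x\in K$): $$\nu(x)=\inf\Big\{\Big\|\sum_{i=1}^s\alpha_iv_i+\omega\Big\|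 : v_i\in\partial f_i(x),\ \omega\in N(x;K),\ \alpha\in\mathbb{R}^s_+,\ \sum_{i=1}^s\alpha_i=1\Big\}.$$ Tangency variety: $\Gamma(f,K)$ is the set of $x\in K$ for which there exist $v_i\in\partial f_i(x)$ ($i=1,\dots,s$) and $(\alpha,\mu)\in\mathbb{R}^s_+\times\mathbb{R}$ with $\sum_{i=1}^s\alpha_i+|\mu|=1$ and $0\in\sum_{i=1}^s\alpha_iv_i+\mu x+N(x;K)$. For $y_0\in\mathbb{R}^s$: $\widetilde K^I_{\infty,\le y_0}(f,K)$ is the set of $y\in\mathbb{R}^{|I|}$ for which there is a sequence $\{x_k\}\subseteq K$ with $f(x_k)\le y_0$ for all $k$, $\|x_k\|\to+\infty$, $f_I(x_k)\to y$ and $\nu(x_k)\to0$. $K^I_{\infty,\le y_0}(f,K)$ is defined in the same way with $\nu(x_k)\to0$ replaced by $\|x_k\|\nu(x_k)\to0$. $T^I_{\infty,\le y_0}(f,K)$ is the set of $y\in\mathbb{R}^{|I|}$ for which there is a sequence $\{x_k\}\subseteq\Gamma(f,K)$ with $f(x_k)\le y_0$ for all $k$, $\|x_k\|\to+\infty$ and $f_I(x_k)\to y$. $f|_K$ satisfies, with respect to $I$ at the sublevel $y_0$: the Palais-Smale condition if $\widetilde K^I_{\infty,\le y_0}(f,K)=\emptyset$; the weak Palais-Smale condition if $K^I_{\infty,\le y_0}(f,K)=\emptyset$; the M-tame condition if $T^I_{\infty,\le y_0}(f,K)=\emptyset$. *)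

theory Defs
  imports "HOL-Analysis.Analysis" "HOL-Library.Landau_Symbols"
begin

(* The library's local_lipschitz is about families of maps depending on a time parameter. *)
definition locally_lipschitz :: "('a::metric_space \<Rightarrow> 'b::metric_space) \<Rightarrow> bool" where
  "locally_lipschitz f \<longleftrightarrow> (\<forall>x. \<exists>u>0. \<exists>L. L-lipschitz_on (ball x u) f)"

(* For an index set I, the space R^|I| is taken to be the coordinate subspace of real^'s
   of the vectors vanishing outside I, with the norm, topology and componentwise order
   that it inherits; sub_vec I is the projection onto it, so f_I(x) is sub_vec I (f x). *)
definition coord_space :: "'s set \<Rightarrow> (real^'s) set" where
  "coord_space I = {y. \<forall>i. i \<notin> I \<longrightarrow> y $ i = 0}"

definition sub_vec :: "'s set \<Rightarrow> real^'s \<Rightarrow> real^'s" where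
  "sub_vec I y = (\<chi> i. if i \<in> I then y $ i else 0)"

definition sublevel_set :: "('a \<Rightarrow> real^'s) \<Rightarrow> 'a set \<Rightarrow> real^'s \<Rightarrow> 'a set" where
  "sublevel_set f K y0 = {x \<in> K. f x \<le> y0}"

definition section_at :: "(real^'s) set \<Rightarrow> real^'s \<Rightarrow> (real^'s) set" where
  "section_at A y0 = A \<inter> {y0 - r | r. 0 \<le> r}"

definition weakly_section_bounded_below ::
    "('a \<Rightarrow> real^'s) \<Rightarrow> 'a set \<Rightarrow> 's set \<Rightarrow> 'a \<Rightarrow> bool" where
  "weakly_section_bounded_below f K I x0 \<longleftrightarrow>
     (\<exists>a \<in> coord_space I.
        {sub_vec I (f x) | x. x \<in> sublevel_set f K (f x0)}
          \<subseteq> {a + r | r. r \<in> coord_space I \<and> 0 \<le> r})"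

definition proper_at_sublevel ::
    "('a::real_normed_vector \<Rightarrow> real^'s) \<Rightarrow> 'a set \<Rightarrow> 's set \<Rightarrow> real^'s \<Rightarrow> bool" where
  "proper_at_sublevel f K I y0 \<longleftrightarrow>
     (\<forall>x :: nat \<Rightarrow> 'a.
        (\<forall>k. x k \<in> K) \<longrightarrow> filterlim (\<lambda>k. norm (x k)) at_top sequentially \<longrightarrow>
        (\<forall>k. f (x k) \<le> y0) \<longrightarrow>
        filterlim (\<lambda>k. norm (sub_vec I (f (x k)))) at_top sequentially)"

(* Both normal cones are only meaningful at points of C. *)
definition regular_normal_cone :: "'a::real_inner \<Rightarrow> 'a set \<Rightarrow> 'a set" where
  "regular_normal_cone xb C =
     {v. \<exists>r \<in> o[at xb within C](\<lambda>x. norm (x - xb)).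
           \<forall>\<^sub>F x in at xb within C. v \<bullet> (x - xb) \<le> r x}"

definition limiting_normal_cone :: "'a::real_inner \<Rightarrow> 'a set \<Rightarrow> 'a set" where
  "limiting_normal_cone xb C =
     {v. \<exists>(x :: nat \<Rightarrow> 'a) (w :: nat \<Rightarrow> 'a).
           (\<forall>k. x k \<in> C \<and> w k \<in> regular_normal_cone (x k) C) \<and>
           x \<longlonglongrightarrow> xb \<and> w \<longlonglongrightarrow> v}"

definition limiting_subdiff :: "('a::real_inner \<Rightarrow> real) \<Rightarrow> 'a \<Rightarrow> 'a set" where
  "limiting_subdiff \<phi> xb = {v. (v, -1) \<in> limiting_normal_cone (xb, \<phi> xb) (epigraph UNIV \<phi>)}"

(* The infimum is the real one: for locally Lipschitz f and x in K the set is nonempty,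
   and it is bounded below by 0. *)
definition rabier ::
    "('a::real_inner \<Rightarrow> real^'s) \<Rightarrow> 'a set \<Rightarrow> 'a \<Rightarrow> real" where
  "rabier f K x =
     Inf {norm ((\<Sum>i\<in>UNIV. (\<alpha> $ i) *\<^sub>R v i) + \<omega>) | (\<alpha> :: real^'s) (v :: 's \<Rightarrow> 'a) \<omega>.
            (\<forall>i. v i \<in> limiting_subdiff (\<lambda>z. f z $ i) x) \<and>
            \<omega> \<in> limiting_normal_cone x K \<and>
            0 \<le> \<alpha> \<and> (\<Sum>i\<in>UNIV. \<alpha> $ i) = 1}"

definition tangency_variety ::
    "('a::real_inner \<Rightarrow> real^'s) \<Rightarrow> 'a set \<Rightarrow> 'a set" where
  "tangency_variety f K =
     {x \<in> K. \<exists>(v :: 's \<Rightarrow> 'a) (\<alpha> :: real^'s) (\<mu> :: real).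
        (\<forall>i. v i \<in> limiting_subdiff (\<lambda>z. f z $ i) x) \<and>
        0 \<le> \<alpha> \<and> (\<Sum>i\<in>UNIV. \<alpha> $ i) + \<bar>\<mu>\<bar> = 1 \<and>
        0 \<in> {(\<Sum>i\<in>UNIV. (\<alpha> $ i) *\<^sub>R v i) + \<mu> *\<^sub>R x + \<omega> | \<omega>. \<omega> \<in> limiting_normal_cone x K}}"

definition PS_values ::
    "('a::real_inner \<Rightarrow> real^'s) \<Rightarrow> 'a set \<Rightarrow> 's set \<Rightarrow> real^'s \<Rightarrow> (real^'s) set" where
  "PS_values f K I y0 =
     {y \<in> coord_space I. \<exists>x :: nat \<Rightarrow> 'a.
        (\<forall>k. x k \<in> K \<and> f (x k) \<le> y0) \<and>
        filterlim (\<lambda>k. norm (x k)) at_top sequentially \<and>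
        (\<lambda>k. sub_vec I (f (x k))) \<longlonglongrightarrow> y \<and>
        (\<lambda>k. rabier f K (x k)) \<longlonglongrightarrow> 0}"

definition weak_PS_values ::
    "('a::real_inner \<Rightarrow> real^'s) \<Rightarrow> 'a set \<Rightarrow> 's set \<Rightarrow> real^'s \<Rightarrow> (real^'s) set" where
  "weak_PS_values f K I y0 =
     {y \<in> coord_space I. \<exists>x :: nat \<Rightarrow> 'a.
        (\<forall>k. x k \<in> K \<and> f (x k) \<le> y0) \<and>
        filterlim (\<lambda>k. norm (x k)) at_top sequentially \<and>
        (\<lambda>k. sub_vec I (f (x k))) \<longlonglongrightarrow> y \<and>
        (\<lambda>k. norm (x k) * rabier f K (x k)) \<longlonglongrightarrow> 0}"

definition tangency_values ::
    "('a::real_inner \<Rightarrow> real^'s) \<Rightarrow> 'a set \<Rightarrow> 's set \<Rightarrow> real^'s \<Rightarrow> (real^'s) set" where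
  "tangency_values f K I y0 =
     {y \<in> coord_space I. \<exists>x :: nat \<Rightarrow> 'a.
        (\<forall>k. x k \<in> tangency_variety f K \<and> f (x k) \<le> y0) \<and>
        filterlim (\<lambda>k. norm (x k)) at_top sequentially \<and>
        (\<lambda>k. sub_vec I (f (x k))) \<longlonglongrightarrow> y}"

definition palais_smale ::
    "('a::real_inner \<Rightarrow> real^'s) \<Rightarrow> 'a set \<Rightarrow> 's set \<Rightarrow> real^'s \<Rightarrow> bool" where
  "palais_smale f K I y0 \<longleftrightarrow> PS_values f K I y0 = {}"

definition weak_palais_smale ::
    "('a::real_inner \<Rightarrow> real^'s) \<Rightarrow> 'a set \<Rightarrow> 's set \<Rightarrow> real^'s \<Rightarrow> bool" where
  "weak_palais_smale f K I y0 \<longleftrightarrow> weak_PS_values f K I y0 = {}"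

definition M_tame ::
    "('a::real_inner \<Rightarrow> real^'s) \<Rightarrow> 'a set \<Rightarrow> 's set \<Rightarrow> real^'s \<Rightarrow> bool" where
  "M_tame f K I y0 \<longleftrightarrow> tangency_values f K I y0 = {}"

end

(* On the sublevel set the components f_i with i in I are bounded, so each of the four conditions
   holds as soon as the sublevel set S is bounded, and properness says just that. Now let S be
   unbounded and F = max_i (f_i - f_i(x0)); F is bounded below on S, and F <= 0 cuts S out of K.
   Every sphere that meets S carries a minimiser of F over its intersection with K, which is a
   tangency point in S. A quadratically perturbed minimisation of F started at an almost minimal
   point x of S far out gives y in S with norm y comparable to norm x and norm y * rabier f K y
   small. Along such sequences f_I has convergent subsequences, so the M-tame and the weak
   Palais-Smale condition fail. Both arguments rest on a multiplier rule with an approximation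
   error at nearby points, combined with a passage to the limit. *)
theory Submission
  imports Defs
begin

text \<open>Minimising the single function F over K does the work of a constrained problem: a point
  of K where F is no larger than at some point of S lies in S again, so the inequalities f \<le>
  f(x0) call for no multipliers of their own. The obstacle is that F is a maximum of nonsmooth
  functions, while \<open>rabier\<close> and \<open>tangency_variety\<close> ask for separate
  subgradients v_i and a normal \<omega>, all based at the same point x. Minimisation yields regular
  normals, and those only at points near x. So the rule is kept in a fuzzy form, with the weights
  carried inside normals to the epigraphs, and a common base point appears only in the limit.
  Compactness for this limit comes from the Lipschitz constant, which bounds the slope part of an
  epigraph normal by L times its vertical part. In particular slopes whose weight tends to 0 vanish,
  and a component of weight 0 may be given any subgradient. The Rabier bound keeps the base point
  fixed and lets only the error tend to 0; the sphere argument also moves the base point, because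
  its multipliers come from a penalty.\<close>

section \<open>Normal cones, epigraphs of Lipschitz functions and subgradients\<close>

lemma regular_normal_cone_iff:
  "v \<in> regular_normal_cone x C \<longleftrightarrow>
     (\<forall>e>0. \<forall>\<^sub>F y in at x within C. v \<bullet> (y - x) \<le> e * norm (y - x))"
proof
  assume "v \<in> regular_normal_cone x C"
  then obtain r where r: "r \<in> o[at x within C](\<lambda>y. norm (y - x))"
    and le: "\<forall>\<^sub>F y in at x within C. v \<bullet> (y - x) \<le> r y"
    unfolding regular_normal_cone_def by blast
  show "\<forall>e>0. \<forall>\<^sub>F y in at x within C. v \<bullet> (y - x) \<le> e * norm (y - x)"
  proof (intro allI impI)
    fix e :: real assume "e > 0"
    from landau_o.smallD[OF r this] le
    show "\<forall>\<^sub>F y in at x within C. v \<bullet> (y - x) \<le> e * norm (y - x)"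
      by eventually_elim auto
  qed
next
  assume *: "\<forall>e>0. \<forall>\<^sub>F y in at x within C. v \<bullet> (y - x) \<le> e * norm (y - x)"
  \<comment> \<open>The positive part serves as the remainder: the inner product itself may be as
    negative as a multiple of the distance, hence need not be small compared with it.\<close>
  have "(\<lambda>y. max 0 (v \<bullet> (y - x))) \<in> o[at x within C](\<lambda>y. norm (y - x))"
  proof (rule landau_o.smallI)
    fix e :: real assume "e > 0"
    with * have "\<forall>\<^sub>F y in at x within C. v \<bullet> (y - x) \<le> e * norm (y - x)" by blast
    then show "\<forall>\<^sub>F y in at x within C. norm (max 0 (v \<bullet> (y - x))) \<le> e * norm (norm (y - x))"
      by eventually_elim (use \<open>e > 0\<close> in auto)
  qed
  moreover have "\<forall>\<^sub>F y in at x within C. v \<bullet> (y - x) \<le> max 0 (v \<bullet> (y - x))" by simp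
  ultimately show "v \<in> regular_normal_cone x C"
    unfolding regular_normal_cone_def by (auto intro!: bexI[of _ "\<lambda>y. max 0 (v \<bullet> (y - x))"] simp del: max.bounded_iff)
qed

lemma regular_normal_cone_scaleR:
  assumes "v \<in> regular_normal_cone x C" "0 \<le> t"
  shows "t *\<^sub>R v \<in> regular_normal_cone x C"
  unfolding regular_normal_cone_iff
proof (intro allI impI)
  fix e :: real assume e: "e > 0"
  \<comment> \<open>The divisor is t + 1 rather than t so that t = 0 is covered too.\<close>
  have "\<forall>\<^sub>F y in at x within C. v \<bullet> (y - x) \<le> e / (t + 1) * norm (y - x)"
    using assms e by (simp only: regular_normal_cone_iff) (simp del: times_divide_eq_left)
  then show "\<forall>\<^sub>F y in at x within C. (t *\<^sub>R v) \<bullet> (y - x) \<le> e * norm (y - x)"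
  proof eventually_elim
    case (elim y)
    have "t * (v \<bullet> (y - x)) \<le> t * (e / (t + 1) * norm (y - x))"
      using elim assms(2) by (rule mult_left_mono)
    also have "\<dots> = (t / (t + 1)) * (e * norm (y - x))" by simp
    also have "\<dots> \<le> 1 * (e * norm (y - x))"
      using assms(2) e by (intro mult_right_mono) auto
    finally show ?case by simp
  qed
qed

lemma limiting_normal_coneI:
  assumes "\<And>k. x k \<in> C" "\<And>k. w k \<in> regular_normal_cone (x k) C" "x \<longlonglongrightarrow> xb" "w \<longlonglongrightarrow> v"
  shows "v \<in> limiting_normal_cone xb C"
  using assms unfolding limiting_normal_cone_def by blast

lemma limiting_normal_cone_scaleR:
  assumes "v \<in> limiting_normal_cone x C" "0 \<le> t"
  shows "t *\<^sub>R v \<in> limiting_normal_cone x C"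
proof -
  obtain y w where *: "\<And>k. y k \<in> C" "\<And>k. w k \<in> regular_normal_cone (y k) C" "y \<longlonglongrightarrow> x" "w \<longlonglongrightarrow> v"
    using assms(1) unfolding limiting_normal_cone_def by blast
  show ?thesis
  proof (rule limiting_normal_coneI)
    show "\<And>k. t *\<^sub>R w k \<in> regular_normal_cone (y k) C"
      using * assms(2) by (simp add: regular_normal_cone_scaleR)
    show "(\<lambda>k. t *\<^sub>R w k) \<longlonglongrightarrow> t *\<^sub>R v" using * by (intro tendsto_intros)
  qed (use * in auto)
qed

text \<open>Fermat's rule. Regular normals are produced below as negative gradients of smooth
  functions at local minimisers over the set.\<close>

lemma regular_normal_cone_minimizer:
  assumes d: "(\<phi> has_derivative (\<lambda>h. g \<bullet> h)) (at x within C)"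
    and m: "\<forall>\<^sub>F y in at x within C. \<phi> x \<le> \<phi> y"
  shows "- g \<in> regular_normal_cone x C"
  unfolding regular_normal_cone_iff
proof (intro allI impI)
  fix e :: real assume e: "e > 0"
  from d obtain \<delta> where \<delta>: "\<delta> > 0"
    and le: "\<And>y. y \<in> C \<Longrightarrow> norm (y - x) < \<delta> \<Longrightarrow> norm (\<phi> y - \<phi> x - g \<bullet> (y - x)) \<le> e * norm (y - x)"
    using e unfolding has_derivative_within_alt by blast
  have "\<forall>\<^sub>F y in at x within C. y \<in> C \<and> norm (y - x) < \<delta>"
    unfolding eventually_at using \<delta> by (auto simp: dist_norm)
  with m show "\<forall>\<^sub>F y in at x within C. - g \<bullet> (y - x) \<le> e * norm (y - x)"
  proof eventually_elim
    case (elim y)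
    then show ?case using le[of y] by auto
  qed
qed

text \<open>The ray from the base point in direction \<open>(w, L * norm w)\<close> stays in the
  epigraph as long as its shadow stays in U, since \<phi> rises at most at rate L. Pairing this
  direction with the normal gives \<open>norm w * (norm w - L * a)\<close>, which therefore cannot
  be positive. For a = 0 this says that horizontal normals vanish.\<close>

lemma regular_normal_epigraph_lipschitz:
  fixes \<phi> :: "'a::real_inner \<Rightarrow> real"
  assumes n: "(w, - a) \<in> regular_normal_cone (x, \<phi> x) (epigraph UNIV \<phi>)"
    and l: "L-lipschitz_on U \<phi>" and U: "open U" "x \<in> U" and a: "0 \<le> a"
  shows "norm w \<le> L * a"
proof (cases "w = 0")
  case False
  have L: "L \<ge> 0" using l by (rule lipschitz_on_nonneg)
  define z where "z = (w, L * norm w)"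
  define p where "p = (x, \<phi> x)"
  have z: "z \<noteq> 0" using False by (simp add: z_def zero_prod_def)
  have line: "((\<lambda>t::real. p + t *\<^sub>R z) \<longlongrightarrow> p) (at_right 0)"
    by (rule tendsto_eq_intros | simp)+
  have "((\<lambda>t::real. x + t *\<^sub>R w) \<longlongrightarrow> x) (at_right 0)"
    by (rule tendsto_eq_intros | simp)+
  then have inU: "\<forall>\<^sub>F t in at_right 0. x + t *\<^sub>R w \<in> U"
    using U by (rule topological_tendstoD)
  have pos: "\<forall>\<^sub>F t::real in at_right 0. 0 < t"
    by (simp add: eventually_at_filter)
  have "\<forall>\<^sub>F t in at_right 0. p + t *\<^sub>R z \<in> epigraph UNIV \<phi> \<and> p + t *\<^sub>R z \<noteq> p"
    using inU pos
  proof eventually_elim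
    case (elim t)
    have "dist (\<phi> (x + t *\<^sub>R w)) (\<phi> x) \<le> L * dist (x + t *\<^sub>R w) x"
      using elim U by (intro lipschitz_onD[OF l]) auto
    then have "\<phi> (x + t *\<^sub>R w) \<le> \<phi> x + t * (L * norm w)"
      using elim by (auto simp: dist_norm algebra_simps)
    then have "p + t *\<^sub>R z \<in> epigraph UNIV \<phi>" by (simp add: p_def z_def epigraph_def)
    moreover have "p + t *\<^sub>R z \<noteq> p" using elim z by simp
    ultimately show ?case by blast
  qed
  then have flim: "filterlim (\<lambda>t::real. p + t *\<^sub>R z) (at p within epigraph UNIV \<phi>) (at_right 0)"
    using line by (simp add: filterlim_at)
  have key: "norm w * (norm w - L * a) \<le> e * norm z" if e: "e > 0" for e
  proof -
    have "\<forall>\<^sub>F y in at p within epigraph UNIV \<phi>. (w, - a) \<bullet> (y - p) \<le> e * norm (y - p)"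
      using n e unfolding regular_normal_cone_iff p_def by blast
    then have "\<forall>\<^sub>F t in at_right 0. (w, - a) \<bullet> (p + t *\<^sub>R z - p) \<le> e * norm (p + t *\<^sub>R z - p)"
      using flim unfolding filterlim_iff by blast
    with pos have "\<forall>\<^sub>F t::real in at_right 0. norm w * (norm w - L * a) \<le> e * norm z"
    proof eventually_elim
      case (elim t)
      then have "t * ((w, - a) \<bullet> z) \<le> t * (e * norm z)" by (simp add: mult.left_commute)
      then have "(w, - a) \<bullet> z \<le> e * norm z" using elim by simp
      then show ?case by (simp add: z_def inner_Pair algebra_simps power2_norm_eq_inner
            flip: power2_eq_square)
    qed
    then show ?thesis by (simp add: eventually_const)
  qed
  have "norm w * (norm w - L * a) \<le> 0"
  proof (rule field_le_epsilon)
    fix e :: real assume "e > 0"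
    then show "norm w * (norm w - L * a) \<le> 0 + e" using key[of "e / norm z"] z by simp
  qed
  then show ?thesis using False by (simp add: mult_le_0_iff)
qed (use a lipschitz_on_nonneg[OF l] in simp)

lemma lipschitz_on_component:
  fixes f :: "'a::metric_space \<Rightarrow> real^'s"
  assumes l: "L-lipschitz_on U f"
  shows "L-lipschitz_on U (\<lambda>x. f x $ i)"
proof (rule lipschitz_onI)
  fix y z assume "y \<in> U" "z \<in> U"
  then have "dist (f y) (f z) \<le> L * dist y z" by (rule lipschitz_onD[OF l])
  then show "dist (f y $ i) (f z $ i) \<le> L * dist y z"
    using dist_vec_nth_le[of "f y" i "f z"] by linarith
qed (rule lipschitz_on_nonneg[OF l])

lemma locally_lipschitz_component:
  fixes f :: "'a::metric_space \<Rightarrow> real^'s"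
  assumes "locally_lipschitz f"
  shows "locally_lipschitz (\<lambda>x. f x $ i)"
  unfolding locally_lipschitz_def
proof
  fix x
  obtain u L where u: "u > 0" "L-lipschitz_on (ball x u) f"
    using assms unfolding locally_lipschitz_def by blast
  have "L-lipschitz_on (ball x u) (\<lambda>x. f x $ i)" using u(2) by (rule lipschitz_on_component)
  then show "\<exists>u>0. \<exists>L. L-lipschitz_on (ball x u) (\<lambda>x. f x $ i)" using u by blast
qed

lemma locally_lipschitz_continuous_on:
  assumes "locally_lipschitz f"
  shows "continuous_on S f"
proof -
  have "isCont f x" for x
  proof -
    obtain u L where u: "u > 0" "L-lipschitz_on (ball x u) f"
      using assms unfolding locally_lipschitz_def by blast
    have "continuous_on (ball x u) f" using u(2) by (rule lipschitz_on_continuous_on)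
    then show ?thesis using u(1) by (simp add: continuous_on_eq_continuous_at)
  qed
  then show ?thesis by (simp add: continuous_at_imp_continuous_on)
qed

text \<open>Near x, minimisers of \<phi> plus k times the squared distance to x tend to x, and
  comparison with x bounds their penalty slopes by 2 L, so a subsequence of slopes converges to a
  subgradient. This supplies a v_i for components whose multiplier is 0.\<close>

lemma limiting_subdiff_nonempty:
  fixes \<phi> :: "'a::euclidean_space \<Rightarrow> real"
  assumes "locally_lipschitz \<phi>"
  shows "limiting_subdiff \<phi> x \<noteq> {}"
proof -
  obtain u L where u: "u > 0" "L-lipschitz_on (ball x u) \<phi>"
    using assms unfolding locally_lipschitz_def by blast
  have L: "L \<ge> 0" using u(2) by (rule lipschitz_on_nonneg)
  define B where "B = cball x (u/2)"
  have B: "compact B" "x \<in> B" "B \<subseteq> ball x u" using u by (auto simp: B_def)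
  have "\<exists>y\<in>B. \<forall>z\<in>B. \<phi> y + real k * norm (y - x) ^ 2 \<le> \<phi> z + real k * norm (z - x) ^ 2" for k
    using B by (intro continuous_attains_inf continuous_intros locally_lipschitz_continuous_on assms) auto
  then obtain y where y: "\<And>k. y k \<in> B"
    and ymin: "\<And>k z. z \<in> B \<Longrightarrow> \<phi> (y k) + real k * norm (y k - x) ^ 2 \<le> \<phi> z + real k * norm (z - x) ^ 2"
    by metis
  have bd: "real k * norm (y k - x) \<le> L" for k
  proof (cases "y k = x")
    case False
    have "real k * norm (y k - x) ^ 2 \<le> \<phi> x - \<phi> (y k)" using ymin[of x k] B by simp
    also have "\<dots> \<le> L * norm (y k - x)"
      using lipschitz_onD[OF u(2), of "y k" x] y[of k] B
      by (fastforce simp: dist_norm abs_le_iff subset_iff)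
    finally have "(real k * norm (y k - x)) * norm (y k - x) \<le> L * norm (y k - x)"
      by (simp add: power2_eq_square)
    then show ?thesis using False by simp
  qed (use L in simp)
  define w where "w k = - (2 * real k) *\<^sub>R (y k - x)" for k
  have "norm (w k) \<le> 2 * L" for k using bd[of k] by (simp add: w_def)
  then have "bounded (range w)" by (auto simp: bounded_iff)
  then obtain v r where r: "strict_mono r" "(w \<circ> r) \<longlonglongrightarrow> v"
    using bounded_imp_convergent_subsequence by blast
  have "(\<lambda>k. norm (y k - x)) \<longlonglongrightarrow> 0"
  proof (rule tendsto_sandwich[of "\<lambda>_. 0" _ _ "\<lambda>k. L / real k"])
    show "\<forall>\<^sub>F k in sequentially. norm (y k - x) \<le> L / real k"
      using eventually_gt_at_top[of 0]
      by eventually_elim (use bd in \<open>auto simp: field_simps\<close>)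
    show "(\<lambda>k. L / real k) \<longlonglongrightarrow> 0" by (rule lim_const_over_n)
  qed auto
  then have ylim: "y \<longlonglongrightarrow> x" by (simp add: tendsto_norm_zero_iff LIM_zero_iff)
  \<comment> \<open>Minimality is known only on \<open>B\<close>; from \<open>n0\<close> on the
    minimiser lies in its interior, so that Fermat's rule applies.\<close>
  then obtain n0 where n0: "\<And>k. k \<ge> n0 \<Longrightarrow> dist (y k) x < u/2"
    unfolding lim_sequentially using u by (meson half_gt_zero)
  have nrm: "(w k, -1) \<in> regular_normal_cone (y k, \<phi> (y k)) (epigraph UNIV \<phi>)" if "k \<ge> n0" for k
  proof -
    have "- ((2 * real k) *\<^sub>R (y k - x), 1) \<in> regular_normal_cone (y k, \<phi> (y k)) (epigraph UNIV \<phi>)"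
    proof (rule regular_normal_cone_minimizer)
      show "((\<lambda>p. snd p + real k * norm (fst p - x) ^ 2) has_derivative
         (\<lambda>h. ((2 * real k) *\<^sub>R (y k - x), 1) \<bullet> h)) (at (y k, \<phi> (y k)) within epigraph UNIV \<phi>)"
        unfolding power2_norm_eq_inner
        by (auto intro!: derivative_eq_intros simp: inner_commute algebra_simps fun_eq_iff inner_prod_def)
      have "\<forall>\<^sub>F p in at (y k, \<phi> (y k)) within epigraph UNIV \<phi>. dist (fst p) x < u/2"
      proof (rule order_tendstoD)
        show "((\<lambda>p. dist (fst p) x) \<longlongrightarrow> dist (y k) x) (at (y k, \<phi> (y k)) within epigraph UNIV \<phi>)"
          by (rule tendsto_eq_intros | simp)+
      qed (use n0 that in auto)
      moreover have "\<forall>\<^sub>F p in at (y k, \<phi> (y k)) within epigraph UNIV \<phi>. p \<in> epigraph UNIV \<phi>"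
        by (simp add: eventually_at_filter)
      ultimately show "\<forall>\<^sub>F p in at (y k, \<phi> (y k)) within epigraph UNIV \<phi>.
          snd (y k, \<phi> (y k)) + real k * norm (fst (y k, \<phi> (y k)) - x) ^ 2
            \<le> snd p + real k * norm (fst p - x) ^ 2"
      proof eventually_elim
        case (elim p)
        then show ?case using ymin[of "fst p" k] by (auto simp: B_def epigraph_def dist_commute)
      qed
    qed
    then show ?thesis by (simp add: w_def)
  qed
  \<comment> \<open>\<open>limiting_normal_cone\<close> asks for a regular normal at every index,
    hence the shift by \<open>n0\<close>.\<close>
  have sub: "filterlim (\<lambda>k. r (k + n0)) at_top sequentially"
    by (intro filterlim_compose[OF filterlim_subseq[OF r(1)]] filterlim_add_const_nat_at_top)
  have "(v, -1) \<in> limiting_normal_cone (x, \<phi> x) (epigraph UNIV \<phi>)"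
  proof (rule limiting_normal_coneI)
    fix k
    show "(y (r (k + n0)), \<phi> (y (r (k + n0)))) \<in> epigraph UNIV \<phi>" by (simp add: epigraph_def)
    show "(w (r (k + n0)), -1) \<in> regular_normal_cone (y (r (k + n0)), \<phi> (y (r (k + n0)))) (epigraph UNIV \<phi>)"
      using seq_suble[OF r(1), of "k + n0"] by (intro nrm) simp
  next
    have 1: "(\<lambda>k. y (r (k + n0))) \<longlonglongrightarrow> x" using ylim sub by (rule filterlim_compose)
    moreover have "isCont \<phi> x"
      using locally_lipschitz_continuous_on[OF assms, of UNIV] by (simp add: continuous_on_eq_continuous_at)
    ultimately have "(\<lambda>k. \<phi> (y (r (k + n0)))) \<longlonglongrightarrow> \<phi> x" by (metis isCont_tendsto_compose)
    with 1 show "(\<lambda>k. (y (r (k + n0)), \<phi> (y (r (k + n0))))) \<longlonglongrightarrow> (x, \<phi> x)" by (rule tendsto_Pair)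
    have "(\<lambda>k. w (r (k + n0))) \<longlonglongrightarrow> v"
      using LIMSEQ_ignore_initial_segment[OF r(2), of n0] by simp
    then show "(\<lambda>k. (w (r (k + n0)), -1)) \<longlonglongrightarrow> (v, -1)" by (intro tendsto_intros)
  qed
  then show ?thesis by (auto simp: limiting_subdiff_def)
qed

section \<open>The maximum of the components and its smoothing\<close>

definition vmax :: "real^'s \<Rightarrow> real" where
  "vmax y = Max (range (($) y))"

lemma vmax_ge: "y $ i \<le> vmax y"
  unfolding vmax_def by (rule Max_ge) auto

lemma vmax_attained: "\<exists>i. vmax y = y $ i"
  using Max_in[of "range (($) y)"] unfolding vmax_def by fastforce

lemma vmax_le_iff: "vmax y \<le> t \<longleftrightarrow> (\<forall>i. y $ i \<le> t)"
  by (metis order_trans vmax_attained vmax_ge)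

lemma continuous_on_vmax: "continuous_on S vmax"
proof (rule lipschitz_on_continuous_on)
  show "1-lipschitz_on S vmax"
  proof (rule lipschitz_onI)
    fix x y :: "real^'a"
    have "vmax a \<le> vmax b + dist a b" for a b :: "real^'a"
      unfolding vmax_le_iff
    proof
      fix i
      show "a $ i \<le> vmax b + dist a b"
        using vmax_ge[of b i] dist_vec_nth_le[of a i b] by (auto simp: dist_real_def)
    qed
    from this[of x y] this[of y x] show "dist (vmax x) (vmax y) \<le> 1 * dist x y"
      by (auto simp: dist_real_def dist_commute)
  qed simp
qed

text \<open>Log-sum-exp with sharpness k: for k > 0 a smooth, componentwise increasing majorant of
  \<open>vmax\<close>, too large by at most \<open>ln (CARD('s)) / k\<close>. Its partial
  derivatives are the weights \<open>softmax k\<close>, nonnegative with sum 1, and these become the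
  multipliers.\<close>

definition lse :: "real \<Rightarrow> real^'s \<Rightarrow> real" where
  "lse k y = ln (\<Sum>i\<in>UNIV. exp (k * y $ i)) / k"

lemma sum_exp_pos: "0 < (\<Sum>i\<in>(UNIV::'s::finite set). exp (h i :: real))"
  by (intro sum_pos) auto

lemma vmax_le_lse:
  assumes "k > 0"
  shows "vmax y \<le> lse k y"
proof -
  obtain i where i: "vmax y = y $ i" using vmax_attained by blast
  have "k * y $ i = ln (exp (k * y $ i))" by simp
  also have "\<dots> \<le> ln (\<Sum>i\<in>UNIV. exp (k * y $ i))"
    by (subst ln_le_cancel_iff) (auto intro!: sum_exp_pos member_le_sum)
  finally show ?thesis using assms i by (simp add: lse_def field_simps)
qed

lemma lse_le_vmax:
  fixes y :: "real^'s"
  assumes "k > 0"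
  shows "lse k y \<le> vmax y + ln (CARD('s)) / k"
proof -
  have "(\<Sum>i\<in>UNIV. exp (k * y $ i)) \<le> (\<Sum>i\<in>(UNIV::'s set). exp (k * vmax y))"
    using assms by (intro sum_mono) (auto intro: vmax_ge)
  also have "\<dots> = CARD('s) * exp (k * vmax y)" by simp
  finally have "ln (\<Sum>i\<in>UNIV. exp (k * y $ i)) \<le> ln (CARD('s) * exp (k * vmax y))"
    by (subst ln_le_cancel_iff) (auto intro!: sum_exp_pos)
  also have "\<dots> = ln (CARD('s)) + k * vmax y" by (subst ln_mult) auto
  finally show ?thesis using assms by (simp add: lse_def field_simps)
qed

lemma lse_mono:
  assumes "k > 0" "\<And>i. x $ i \<le> y $ i"
  shows "lse k x \<le> lse k y"
proof -
  have "ln (\<Sum>i\<in>UNIV. exp (k * x $ i)) \<le> ln (\<Sum>i\<in>UNIV. exp (k * y $ i))"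
    using assms by (subst ln_le_cancel_iff) (auto intro!: sum_exp_pos sum_mono)
  then show ?thesis using assms by (simp add: lse_def divide_right_mono)
qed

lemma continuous_on_lse: "continuous_on S g \<Longrightarrow> continuous_on S (\<lambda>x. lse k (g x))"
  unfolding lse_def divide_inverse
  by (intro continuous_intros) (auto simp: less_imp_neq[OF sum_exp_pos, symmetric])

definition softmax :: "real \<Rightarrow> real^'s \<Rightarrow> real^'s" where
  "softmax k y = (\<chi> i. exp (k * y $ i) / (\<Sum>j\<in>UNIV. exp (k * y $ j)))"

lemma softmax_nonneg: "0 \<le> softmax k y"
  by (auto simp: softmax_def less_eq_vec_def sum_nonneg)

lemma sum_softmax: "(\<Sum>i\<in>UNIV. softmax k y $ i) = 1"
  using sum_exp_pos[of "\<lambda>i. k * y $ i"] by (simp add: softmax_def flip: sum_divide_distrib)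

lemma lse_partial_derivative:
  assumes "k > 0"
  shows "((\<lambda>t. lse k (\<chi> j. if j = i then t else y $ j)) has_real_derivative softmax k y $ i) (at (y $ i))"
proof -
  define A where "A = (\<Sum>j\<in>UNIV - {i}. exp (k * y $ j))"
  have A: "A \<ge> 0" by (simp add: A_def sum_nonneg)
  have "(\<lambda>t. lse k (\<chi> j. if j = i then t else y $ j)) = (\<lambda>t. ln (exp (k * t) + A) / k)"
    unfolding lse_def A_def
    by (subst sum.remove[of UNIV i]) (auto intro!: ext arg_cong[where f = ln] sum.cong)
  moreover have "(\<Sum>j\<in>UNIV. exp (k * y $ j)) = exp (k * y $ i) + A"
    unfolding A_def by (subst sum.remove[of UNIV i]) auto
  moreover have "((\<lambda>t. ln (exp (k * t) + A) / k) has_real_derivative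
      exp (k * y $ i) / (exp (k * y $ i) + A)) (at (y $ i))"
  proof -
    have pos: "exp (k * y $ i) + A > 0" using A by (simp add: add_pos_nonneg)
    have "((\<lambda>t. ln (exp (k * t) + A) / k) has_real_derivative
      ((exp (k * y $ i) * k) / (exp (k * y $ i) + A)) / k) (at (y $ i))"
      using pos by (auto intro!: derivative_eq_intros)
    then show ?thesis using assms by simp
  qed
  ultimately show ?thesis by (simp add: softmax_def)
qed

section \<open>The multiplier rule with an error and its limit\<close>

text \<open>Each component has its own base point X_i near x, and p stands for the gradient of a
  smooth extra term. The weight a_i is the vertical part of an epigraph normal instead of a factor
  in front of a subgradient, so that a_i = 0 is allowed and the notion is stable under scaling and
  limits. The weights are not normalised, which leaves room for rescaling large multipliers.\<close>

definition approx_multiplier ::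
    "('a::euclidean_space \<Rightarrow> real^'s) \<Rightarrow> 'a set \<Rightarrow> 'a \<Rightarrow> real^'s \<Rightarrow> 'a \<Rightarrow> real \<Rightarrow> bool" where
  "approx_multiplier f K x a p e \<longleftrightarrow> 0 \<le> a \<and>
     (\<exists>(X :: 'a^'s) W u \<omega>.
        (\<forall>i. dist (X $ i) x < e \<and>
           (W $ i, - (a $ i)) \<in> regular_normal_cone (X $ i, f (X $ i) $ i) (epigraph UNIV (\<lambda>z. f z $ i))) \<and>
        u \<in> K \<and> dist u x < e \<and> \<omega> \<in> regular_normal_cone u K \<and>
        norm ((\<Sum>i\<in>UNIV. W $ i) + \<omega> + p) < e)"

text \<open>The conditions on the normals are conic, and a factor at most 1 does not enlarge the
  residual. This is what normalises unbounded penalty multipliers.\<close>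

lemma approx_multiplier_scaleR:
  assumes "approx_multiplier f K x a p e" "0 \<le> t" "t \<le> 1"
  shows "approx_multiplier f K x (t *\<^sub>R a) (t *\<^sub>R p) e"
proof -
  obtain X W u \<omega> where a: "0 \<le> a"
    and X: "\<And>i. dist (X $ i) x < e"
    and W: "\<And>i. (W $ i, - (a $ i)) \<in> regular_normal_cone (X $ i, f (X $ i) $ i) (epigraph UNIV (\<lambda>z. f z $ i))"
    and u: "u \<in> K" "dist u x < e" "\<omega> \<in> regular_normal_cone u K"
    and n: "norm ((\<Sum>i\<in>UNIV. W $ i) + \<omega> + p) < e"
    using assms(1) unfolding approx_multiplier_def by blast
  have "(\<Sum>i\<in>UNIV. (t *\<^sub>R W) $ i) + t *\<^sub>R \<omega> + t *\<^sub>R p = t *\<^sub>R ((\<Sum>i\<in>UNIV. W $ i) + \<omega> + p)"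
    by (simp add: scaleR_sum_right scaleR_add_right)
  then have "norm ((\<Sum>i\<in>UNIV. (t *\<^sub>R W) $ i) + t *\<^sub>R \<omega> + t *\<^sub>R p)
      = t * norm ((\<Sum>i\<in>UNIV. W $ i) + \<omega> + p)" using assms(2) by simp
  also have "\<dots> \<le> 1 * norm ((\<Sum>i\<in>UNIV. W $ i) + \<omega> + p)"
    using assms by (intro mult_right_mono) auto
  finally have "norm ((\<Sum>i\<in>UNIV. (t *\<^sub>R W) $ i) + t *\<^sub>R \<omega> + t *\<^sub>R p) < e" using n by simp
  moreover have "((t *\<^sub>R W) $ i, - ((t *\<^sub>R a) $ i))
      \<in> regular_normal_cone (X $ i, f (X $ i) $ i) (epigraph UNIV (\<lambda>z. f z $ i))" for i
    using regular_normal_cone_scaleR[OF W[of i] assms(2)] by simp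
  moreover have "0 \<le> t *\<^sub>R a" using a assms(2) by (auto simp: less_eq_vec_def)
  moreover have "t *\<^sub>R \<omega> \<in> regular_normal_cone u K"
    using u assms(2) by (intro regular_normal_cone_scaleR)
  ultimately show ?thesis using X u(1,2) unfolding approx_multiplier_def by blast
qed

lemma approx_multiplier_move:
  assumes "approx_multiplier f K x a p e" "e + dist x y \<le> e'"
  shows "approx_multiplier f K y a p e'"
proof -
  have "dist z y < e'" if "dist z x < e" for z
    using dist_triangle[of z y x] that assms(2) by simp
  moreover have "r < e'" if "r < e" for r :: real
    using that assms(2) zero_le_dist[of x y] by linarith
  ultimately show ?thesis using assms(1) unfolding approx_multiplier_def by meson
qed

text \<open>The functions are decoupled: each gets its own copy of the variable, tied to a common point
  of the constraint set by a quadratic penalty, and the maximum is replaced by a smooth one.\<close>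

lemma fuzzy_multiplier_rule:
  fixes f :: "'a::euclidean_space \<Rightarrow> real^'s"
  assumes f: "locally_lipschitz f" and K: "closed K" "x \<in> K"
    and q: "\<And>y. (q has_derivative (\<lambda>h. G y \<bullet> h)) (at y)" and G: "isCont G x"
    and r: "r > 0"
    and min: "\<And>y. y \<in> K \<Longrightarrow> dist x y \<le> r \<Longrightarrow> vmax (f x - c) + q x \<le> vmax (f y - c) + q y"
    and e: "e > 0"
  shows "\<exists>a. (\<Sum>i\<in>UNIV. a $ i) = 1 \<and> approx_multiplier f K x a (G x) e"
proof -
  obtain u0 L where u0: "u0 > 0" "L-lipschitz_on (ball x u0) f"
    using f unfolding locally_lipschitz_def by blast
  have L: "L \<ge> 0" using u0(2) by (rule lipschitz_on_nonneg)
  \<comment> \<open>Within distance \<rho> of x both the minimality of x and the Lipschitz bound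
    hold. Below, \<eta> is the accuracy aimed at: at most \<rho> for interior minimisers, at most d
    for G, and at most e/4 so that e/2 + 2 \<eta> stays within e.\<close>
  define \<rho> where "\<rho> = Min {r, u0/2}"
  have \<rho>: "\<rho> > 0" "\<rho> \<le> r" "\<rho> < u0" using r u0 by (auto simp: \<rho>_def)
  obtain d where d: "d > 0" and Gd: "\<And>y. dist y x < d \<Longrightarrow> dist (G y) (G x) < e/2"
    using G e unfolding continuous_at_eps_delta by (meson half_gt_zero)
  define \<eta> where "\<eta> = Min {\<rho>, d, e/4}"
  have \<eta>: "\<eta> > 0" "\<eta> \<le> \<rho>" "\<eta> \<le> d" "\<eta> \<le> e/4" using \<rho> d e by (auto simp: \<eta>_def)
  \<comment> \<open>Comparing the minimiser of the penalised problem with x leaves an error B / k: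
    the logarithm is the smoothing gap, the other term the price of Young's inequality below. The
    choice of k pushes this below half of the square of \<eta>; k at least 2 lets k / 2 * S dominate
    S.\<close>
  define B where "B = ln (CARD('s)) + CARD('s) * (L\<^sup>2 / 2)"
  have B: "B \<ge> 0" by (simp add: B_def)
  define k where "k = 2 + 2 * B / \<eta>\<^sup>2"
  have k: "k \<ge> 2" "B / k < \<eta>\<^sup>2 / 2"
  proof -
    show k2: "k \<ge> 2" using B by (simp add: k_def)
    have "2 * B < k * \<eta>\<^sup>2" using \<eta>(1) by (simp add: k_def field_simps)
    then show "B / k < \<eta>\<^sup>2 / 2" using k2 by (simp add: field_simps)
  qed
  \<comment> \<open>x need not be a strict minimiser; the last term singles it out, so that the
    minimiser of \<Phi> has to be close to x.\<close>
  define \<Phi> :: "'a^'s \<Rightarrow> 'a \<Rightarrow> real" where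
    "\<Phi> X u = lse k (\<chi> i. f (X $ i) $ i - c $ i) + q u + k * (\<Sum>i\<in>UNIV. (norm (X $ i - u))\<^sup>2) + (norm (u - x))\<^sup>2" for X u
  define D :: "(('a^'s) \<times> 'a) set" where "D = {X. \<forall>i. X $ i \<in> cball x \<rho>} \<times> (cball x \<rho> \<inter> K)"
  have contq: "continuous_on S q" for S
    using q by (meson continuous_at_imp_continuous_on has_derivative_continuous)
  have contf: "continuous_on S (\<lambda>p. f (g p))" if "continuous_on S g" for S :: "(('a^'s) \<times> 'a) set" and g
    using that locally_lipschitz_continuous_on[OF f, of UNIV] by (auto intro: continuous_on_compose2)
  have "compact {X :: 'a^'s. \<forall>i. X $ i \<in> cball x \<rho>}"
  proof -
    have "closed {X :: 'a^'s. \<forall>i. X $ i \<in> cball x \<rho>}"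
      by (simp add: mem_cball) (intro closed_Collect_all closed_Collect_le continuous_intros)
    moreover have "bounded {X :: 'a^'s. \<forall>i. X $ i \<in> cball x \<rho>}"
    proof (rule boundedI)
      fix X :: "'a^'s" assume X: "X \<in> {X. \<forall>i. X $ i \<in> cball x \<rho>}"
      have "norm X \<le> (\<Sum>i\<in>UNIV. norm (X $ i))" unfolding norm_vec_def by (rule L2_set_le_sum) simp
      also have "\<dots> \<le> (\<Sum>i\<in>(UNIV::'s set). norm x + \<rho>)"
      proof (rule sum_mono)
        fix i
        show "norm (X $ i) \<le> norm x + \<rho>"
        proof -
          have "dist x (X $ i) \<le> \<rho>" using X by simp
          then show ?thesis using norm_triangle_sub[of "X $ i" x] by (simp add: dist_norm norm_minus_commute)
        qed
      qed
      finally show "norm X \<le> (\<Sum>i\<in>(UNIV::'s set). norm x + \<rho>)" .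
    qed
    ultimately show ?thesis by (simp add: compact_eq_bounded_closed)
  qed
  then have "compact D" unfolding D_def using K by (intro compact_Times compact_Int_closed) auto
  moreover have xD: "((\<chi> i. x), x) \<in> D" using K \<rho> by (auto simp: D_def)
  moreover have "continuous_on D (\<lambda>p. \<Phi> (fst p) (snd p))" unfolding \<Phi>_def
    by (intro continuous_intros continuous_on_lse continuous_on_vec_lambda contf
        continuous_on_compose2[OF contq[of UNIV]]) auto
  ultimately have "\<exists>p\<in>D. \<forall>p'\<in>D. \<Phi> (fst p) (snd p) \<le> \<Phi> (fst p') (snd p')"
    by (intro continuous_attains_inf) auto
  then obtain X u where "(X, u) \<in> D"
    and opt: "\<And>X' u'. (X', u') \<in> D \<Longrightarrow> \<Phi> X u \<le> \<Phi> X' u'" by fastforce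
  then have X: "\<And>i. dist x (X $ i) \<le> \<rho>" and u: "dist x u \<le> \<rho>" "u \<in> K" by (auto simp: D_def)
  define S where "S = (\<Sum>i\<in>UNIV. (norm (X $ i - u))\<^sup>2)"
  define T where "T = (\<Sum>i\<in>UNIV. norm (X $ i - u))"
  have up: "\<Phi> X u \<le> vmax (f x - c) + ln (CARD('s)) / k + q x"
  proof -
    have "(\<chi> i. f ((\<chi> i. x) $ i) $ i - c $ i) = f x - c" by (simp add: vec_eq_iff)
    then have "\<Phi> (\<chi> i. x) x = lse k (f x - c) + q x" by (simp add: \<Phi>_def)
    then show ?thesis using opt[OF xD] lse_le_vmax[of k "f x - c"] k by simp
  qed
  \<comment> \<open>All copies are pulled back to the common point u, which lies in K and competes
    with x. By the Lipschitz bound this costs at most L * T.\<close>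
  have lo: "vmax (f x - c) + q x - L * T + k * S + (norm (u - x))\<^sup>2 \<le> \<Phi> X u"
  proof -
    have "vmax (f u - c) \<le> vmax (\<chi> i. f (X $ i) $ i - c $ i) + L * T"
      unfolding vmax_le_iff
    proof
      fix i
      have "dist (f u $ i) (f (X $ i) $ i) \<le> dist (f u) (f (X $ i))" by (rule dist_vec_nth_le)
      also have "\<dots> \<le> L * dist u (X $ i)"
        using X[of i] u \<rho> by (intro lipschitz_onD[OF u0(2)]) auto
      also have "\<dots> \<le> L * T"
        using member_le_sum[of i UNIV "\<lambda>i. norm (X $ i - u)"] L
        by (intro mult_left_mono) (auto simp: T_def dist_norm norm_minus_commute)
      finally show "(f u - c) $ i \<le> vmax (\<chi> i. f (X $ i) $ i - c $ i) + L * T"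
        using vmax_ge[of "\<chi> i. f (X $ i) $ i - c $ i" i] by (auto simp: dist_real_def)
    qed
    moreover have "vmax (\<chi> i. f (X $ i) $ i - c $ i) \<le> lse k (\<chi> i. f (X $ i) $ i - c $ i)"
      using k by (intro vmax_le_lse) simp
    moreover have "vmax (f x - c) + q x \<le> vmax (f u - c) + q u" using min u \<rho> by simp
    ultimately show ?thesis by (simp add: \<Phi>_def S_def)
  qed
  \<comment> \<open>Half of the penalty k * S absorbs L * T; the other half still controls the
    spread of the copies.\<close>
  have young: "L * T \<le> k / 2 * S + CARD('s) * (L\<^sup>2 / 2) / k"
  proof -
    have "L * T = (\<Sum>i\<in>UNIV. L * norm (X $ i - u))" by (simp add: T_def sum_distrib_left)
    also have "\<dots> \<le> (\<Sum>i\<in>UNIV. k / 2 * (norm (X $ i - u))\<^sup>2 + (L\<^sup>2 / 2) / k)"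
    proof (rule sum_mono)
      fix i
      have "0 \<le> (k * norm (X $ i - u) - L)\<^sup>2" by simp
      then show "L * norm (X $ i - u) \<le> k / 2 * (norm (X $ i - u))\<^sup>2 + (L\<^sup>2 / 2) / k"
        using k by (simp add: field_simps power2_eq_square)
    qed
    also have "\<dots> = k / 2 * S + CARD('s) * (L\<^sup>2 / 2) / k"
      by (simp add: sum.distrib S_def sum_distrib_left)
    finally show ?thesis .
  qed
  have small: "k / 2 * S + (norm (u - x))\<^sup>2 \<le> B / k"
    using up lo young by (simp add: B_def add_divide_distrib)
  have S0: "S \<ge> 0" by (simp add: S_def sum_nonneg)
  have "0 \<le> k / 2 * S" using k S0 by simp
  then have ux2: "(norm (u - x))\<^sup>2 < \<eta>\<^sup>2 / 2" using small k(2) by linarith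
  have "S \<le> k / 2 * S" using mult_right_mono[of 2 k S] k S0 by simp
  then have Xu: "(norm (X $ i - u))\<^sup>2 + (norm (u - x))\<^sup>2 < \<eta>\<^sup>2 / 2" for i
  proof -
    have "(norm (X $ i - u))\<^sup>2 \<le> S" unfolding S_def by (rule member_le_sum) auto
    then show ?thesis using small k(2) \<open>S \<le> k / 2 * S\<close> by linarith
  qed
  have Xx: "dist (X $ i) x < \<eta>" for i
  proof -
    have "(norm (X $ i - x))\<^sup>2 \<le> (norm (X $ i - u) + norm (u - x))\<^sup>2"
      using norm_triangle_ineq[of "X $ i - u" "u - x"] by (intro power_mono) auto
    also have "\<dots> \<le> 2 * ((norm (X $ i - u))\<^sup>2 + (norm (u - x))\<^sup>2)"
      using sum_squares_bound[of "norm (X $ i - u)" "norm (u - x)"] by (simp add: power2_sum)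
    also have "\<dots> < \<eta>\<^sup>2" using Xu[of i] by simp
    finally show ?thesis using \<eta> by (simp add: dist_norm power2_less_imp_less)
  qed
  have ux: "dist u x < \<eta>"
  proof -
    have "(norm (u - x))\<^sup>2 < \<eta>\<^sup>2" using ux2 zero_le_power2[of \<eta>] by linarith
    then show ?thesis using \<eta> by (simp add: dist_norm power2_less_imp_less)
  qed
  define y :: "real^'s" where "y = (\<chi> i. f (X $ i) $ i - c $ i)"
  \<comment> \<open>The weights are the partial derivatives of the smoothed maximum. W collects the
    negative gradients of the penalty in the separate copies, and \<omega> is the negative gradient
    of all terms that depend on u.\<close>
  define a where "a = softmax k y"
  define W where "W = (\<chi> i. - (2 * k) *\<^sub>R (X $ i - u))"
  define \<omega> where "\<omega> = - (G u + (\<Sum>i\<in>UNIV. - (2 * k) *\<^sub>R (X $ i - u)) + 2 *\<^sub>R (u - x))"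
  have "\<omega> \<in> regular_normal_cone u K" unfolding \<omega>_def
  proof (rule regular_normal_cone_minimizer)
    show "((\<lambda>z. q z + k * (\<Sum>i\<in>UNIV. (norm (X $ i - z))\<^sup>2) + (norm (z - x))\<^sup>2) has_derivative
        (\<lambda>h. (G u + (\<Sum>i\<in>UNIV. - (2 * k) *\<^sub>R (X $ i - u)) + 2 *\<^sub>R (u - x)) \<bullet> h)) (at u within K)"
      unfolding power2_norm_eq_inner
      by (auto intro!: derivative_eq_intros has_derivative_at_withinI[OF q] simp: inner_commute
          algebra_simps fun_eq_iff inner_sum_left inner_sum_right sum_distrib_left sum.distrib sum_subtractf sum_negf)
    have "((\<lambda>z. dist x z) \<longlongrightarrow> dist x u) (at u within K)" by (rule tendsto_eq_intros | simp)+
    then have "\<forall>\<^sub>F z in at u within K. dist x z < \<rho>"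
      using ux \<eta> by (intro order_tendstoD) (auto simp: dist_commute)
    moreover have "\<forall>\<^sub>F z in at u within K. z \<in> K" by (simp add: eventually_at_filter)
    ultimately show "\<forall>\<^sub>F z in at u within K. q u + k * (\<Sum>i\<in>UNIV. (norm (X $ i - u))\<^sup>2) + (norm (u - x))\<^sup>2
        \<le> q z + k * (\<Sum>i\<in>UNIV. (norm (X $ i - z))\<^sup>2) + (norm (z - x))\<^sup>2"
    proof eventually_elim
      case (elim z)
      then have "(X, z) \<in> D" using X by (simp add: D_def)
      from opt[OF this] show ?case by (simp add: \<Phi>_def)
    qed
  qed
  moreover have "(W $ i, - (a $ i)) \<in> regular_normal_cone (X $ i, f (X $ i) $ i) (epigraph UNIV (\<lambda>z. f z $ i))" for i
  proof -
    \<comment> \<open>Only copy i moves, and its value of f_i is replaced by the height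
      \<open>snd p\<close>, which makes the function smooth. Since \<open>lse\<close> is increasing,
      the graph point remains a local minimiser over the epigraph.\<close>
    let ?g = "\<lambda>p. lse k (\<chi> j. if j = i then snd p - c $ i else y $ j) + k * (norm (fst p - u))\<^sup>2"
    let ?E = "epigraph UNIV (\<lambda>z. f z $ i)"
    let ?p = "(X $ i, f (X $ i) $ i)"
    have "- ((2 * k) *\<^sub>R (X $ i - u), a $ i) \<in> regular_normal_cone ?p ?E"
    proof (rule regular_normal_cone_minimizer)
      have "((\<lambda>t. lse k (\<chi> j. if j = i then t else y $ j)) has_derivative (\<lambda>h. a $ i * h)) (at (snd ?p - c $ i))"
        using lse_partial_derivative[of k i y] k
        by (simp add: y_def a_def has_field_derivative_def)
      moreover have "((\<lambda>p. snd p - c $ i) has_derivative snd) (at ?p within ?E)"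
        by (auto intro!: derivative_eq_intros)
      ultimately
      have "((\<lambda>p. lse k (\<chi> j. if j = i then snd p - c $ i else y $ j)) has_derivative (\<lambda>h. a $ i * snd h)) (at ?p within ?E)"
        using has_derivative_compose[where f = "\<lambda>p. snd p - c $ i" and f' = snd and x = ?p and s = ?E] by blast
      then show "(?g has_derivative (\<lambda>h. ((2 * k) *\<^sub>R (X $ i - u), a $ i) \<bullet> h)) (at ?p within ?E)"
        unfolding power2_norm_eq_inner
        by (auto intro!: derivative_eq_intros simp: inner_commute algebra_simps fun_eq_iff inner_prod_def)
      have "((\<lambda>p. dist x (fst p)) \<longlongrightarrow> dist x (X $ i)) (at ?p within ?E)"
        by (rule tendsto_eq_intros | simp)+
      then have "\<forall>\<^sub>F p in at ?p within ?E. dist x (fst p) < \<rho>"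
        using Xx[of i] \<eta> by (intro order_tendstoD) (auto simp: dist_commute)
      moreover have "\<forall>\<^sub>F p in at ?p within ?E. p \<in> ?E" by (simp add: eventually_at_filter)
      ultimately show "\<forall>\<^sub>F p in at ?p within ?E. ?g ?p \<le> ?g p"
      proof eventually_elim
        case (elim p)
        define X' where "X' = (\<chi> j. if j = i then fst p else X $ j)"
        have "(X', u) \<in> D" using elim X u by (simp add: D_def X'_def)
        from opt[OF this]
        have "lse k y + k * (\<Sum>i\<in>UNIV. (norm (X $ i - u))\<^sup>2)
          \<le> lse k (\<chi> j. f (X' $ j) $ j - c $ j) + k * (\<Sum>j\<in>UNIV. (norm (X' $ j - u))\<^sup>2)"
          by (simp add: \<Phi>_def y_def)
        also have "(\<Sum>i\<in>UNIV. (norm (X $ i - u))\<^sup>2) = (norm (X $ i - u))\<^sup>2 + (\<Sum>i\<in>UNIV - {i}. (norm (X $ i - u))\<^sup>2)"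
          by (rule sum.remove) auto
        also have "(\<Sum>j\<in>UNIV. (norm (X' $ j - u))\<^sup>2) = (norm (fst p - u))\<^sup>2 + (\<Sum>i\<in>UNIV - {i}. (norm (X $ i - u))\<^sup>2)"
          by (subst sum.remove[of UNIV i]) (auto simp: X'_def intro!: sum.cong)
        finally have "lse k y + k * (norm (X $ i - u))\<^sup>2
          \<le> lse k (\<chi> j. f (X' $ j) $ j - c $ j) + k * (norm (fst p - u))\<^sup>2" by (simp add: algebra_simps)
        moreover have "lse k (\<chi> j. f (X' $ j) $ j - c $ j) \<le> lse k (\<chi> j. if j = i then snd p - c $ i else y $ j)"
          using elim k by (intro lse_mono) (auto simp: X'_def y_def epigraph_def)
        moreover have "(\<chi> j. if j = i then snd ?p - c $ i else y $ j) = y" by (simp add: y_def vec_eq_iff)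
        ultimately show ?case by simp
      qed
    qed
    then show ?thesis by (simp add: W_def)
  qed
  moreover have "norm ((\<Sum>i\<in>UNIV. W $ i) + \<omega> + G x) < e"
  proof -
    \<comment> \<open>The pulls between the copies and u cancel in the sum; what is left is the
      variation of G and the gradient of the localising term.\<close>
    have "(\<Sum>i\<in>UNIV. W $ i) + \<omega> + G x = (G x - G u) - 2 *\<^sub>R (u - x)"
      by (simp add: W_def \<omega>_def)
    also have "norm \<dots> \<le> dist (G u) (G x) + 2 * dist u x"
      by (rule order_trans[OF norm_triangle_ineq4]) (simp add: dist_norm norm_minus_commute)
    also have "\<dots> < e" using Gd[of u] ux \<eta> by linarith
    finally show ?thesis .
  qed
  moreover have "dist (X $ i) x < e" for i using Xx[of i] \<eta> e by linarith
  moreover have "dist u x < e" using ux \<eta> e by linarith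
  ultimately have "approx_multiplier f K x a (G x) e"
    using u(2) softmax_nonneg[of k y] unfolding approx_multiplier_def a_def by blast
  moreover have "(\<Sum>i\<in>UNIV. a $ i) = 1" by (simp add: a_def sum_softmax)
  ultimately show ?thesis by blast
qed

text \<open>Once the points X_i enter a ball where f is L-Lipschitz, the slopes W_i are bounded by L
  times the weights, so a subsequence converges. Since the base points tend to x, the limits are
  limiting normals at x itself.\<close>

lemma approx_multiplier_limit:
  fixes f :: "'a::euclidean_space \<Rightarrow> real^'s"
  assumes f: "locally_lipschitz f"
    and am: "\<And>n. approx_multiplier f K x (a n) (p n) (e n)"
    and lims: "e \<longlonglongrightarrow> 0" "a \<longlonglongrightarrow> a'" "p \<longlonglongrightarrow> p'"
  shows "\<exists>v \<omega>. (\<forall>i. v i \<in> limiting_subdiff (\<lambda>z. f z $ i) x) \<and> \<omega> \<in> limiting_normal_cone x K \<and>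
     0 \<le> a' \<and> (\<Sum>i\<in>UNIV. a' $ i *\<^sub>R v i) + \<omega> + p' = 0"
proof -
  let ?E = "\<lambda>i. epigraph UNIV (\<lambda>z. f z $ i)"
  define P where "P n X W u \<omega> \<longleftrightarrow> (\<forall>i. dist (X $ i) x < e n \<and>
           (W $ i, - (a n $ i)) \<in> regular_normal_cone (X $ i, f (X $ i) $ i) (?E i)) \<and>
        u \<in> K \<and> dist u x < e n \<and> \<omega> \<in> regular_normal_cone u K \<and>
        norm ((\<Sum>i\<in>UNIV. W $ i) + \<omega> + p n) < e n"
    for n and X W :: "'a^'s" and u \<omega>
  have "\<forall>n. \<exists>X W u \<omega>. P n X W u \<omega>"
    using am unfolding approx_multiplier_def P_def by simp
  then obtain X W u \<omega> where P: "\<And>n. P n (X n) (W n) (u n) (\<omega> n)"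
    unfolding choice_iff by blast
  have X: "dist (X n $ i) x < e n"
    and W: "(W n $ i, - (a n $ i)) \<in> regular_normal_cone (X n $ i, f (X n $ i) $ i) (?E i)"
    and u: "u n \<in> K" "dist (u n) x < e n" "\<omega> n \<in> regular_normal_cone (u n) K"
    and res: "norm ((\<Sum>i\<in>UNIV. W n $ i) + \<omega> n + p n) < e n" for n i
    using P[of n] by (simp_all add: P_def)
  have a0: "0 \<le> a n $ i" for n i using am[of n] by (auto simp: approx_multiplier_def less_eq_vec_def)
  have alim: "(\<lambda>n. a n $ i) \<longlonglongrightarrow> a' $ i" for i using lims(2) by (rule tendsto_vec_nth)
  have a'0: "0 \<le> a' $ i" for i by (rule LIMSEQ_le_const[OF alim]) (use a0 in auto)
  obtain u0 L where u0: "u0 > 0" "L-lipschitz_on (ball x u0) f"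
    using f unfolding locally_lipschitz_def by blast
  have "\<forall>\<^sub>F n in sequentially. e n < u0" using lims(1) u0(1) by (rule order_tendstoD)
  then obtain n0 where n0: "\<And>n. n \<ge> n0 \<Longrightarrow> e n < u0" by (auto simp: eventually_sequentially)
  have Wbd: "norm (W n $ i) \<le> L * a n $ i" if "n \<ge> n0" for n i
  proof (rule regular_normal_epigraph_lipschitz[OF W])
    show "L-lipschitz_on (ball x u0) (\<lambda>z. f z $ i)"
      using u0(2) by (rule lipschitz_on_component)
    show "X n $ i \<in> ball x u0" using X[of n i] n0[OF that] by (simp add: dist_commute)
  qed (use a0 in auto)
  obtain A where A: "\<And>n. norm (a n) \<le> A"
    using convergent_imp_bounded[OF lims(2)] by (auto simp: bounded_iff)
  have L: "L \<ge> 0" using u0(2) by (rule lipschitz_on_nonneg)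
  have "bounded (range (\<lambda>n. W (n + n0)))"
  proof (rule boundedI)
    fix w assume "w \<in> range (\<lambda>n. W (n + n0))"
    then obtain n where w: "w = W (n + n0)" by blast
    have "norm w \<le> (\<Sum>i\<in>UNIV. norm (w $ i))" unfolding norm_vec_def by (rule L2_set_le_sum) simp
    also have "\<dots> \<le> (\<Sum>i\<in>(UNIV::'s set). L * A)"
    proof (rule sum_mono)
      fix i
      have "norm (w $ i) \<le> L * a (n + n0) $ i" unfolding w by (rule Wbd) simp
      also have "\<dots> \<le> L * A"
        using component_le_norm_cart[of "a (n + n0)" i] A[of "n + n0"] L by (intro mult_left_mono) auto
      finally show "norm (w $ i) \<le> L * A" .
    qed
    finally show "norm w \<le> (\<Sum>i\<in>(UNIV::'s set). L * A)" .
  qed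
  then obtain W' s where s: "strict_mono s" "((\<lambda>n. W (n + n0)) \<circ> s) \<longlonglongrightarrow> W'"
    using bounded_imp_convergent_subsequence by blast
  define r where "r n = s n + n0" for n
  have r: "filterlim r at_top sequentially" unfolding r_def
    by (intro filterlim_compose[OF filterlim_add_const_nat_at_top] filterlim_subseq s)
  have rn: "r n \<ge> n0" for n by (simp add: r_def)
  have Wlim: "(\<lambda>n. W (r n)) \<longlonglongrightarrow> W'" using s(2) by (simp add: r_def o_def)
  then have Wlimi: "(\<lambda>n. W (r n) $ i) \<longlonglongrightarrow> W' $ i" for i by (rule tendsto_vec_nth)
  have ar: "(\<lambda>n. a (r n) $ i) \<longlonglongrightarrow> a' $ i" for i using alim r by (rule filterlim_compose)
  have pr: "(\<lambda>n. p (r n)) \<longlonglongrightarrow> p'" using lims(3) r by (rule filterlim_compose)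
  have er: "(\<lambda>n. e (r n)) \<longlonglongrightarrow> 0" using lims(1) r by (rule filterlim_compose)
  have squeeze: "g \<longlonglongrightarrow> x" if "\<And>n. dist (g n) x < e (r n)" for g
  proof -
    have "(\<lambda>n. dist (g n) x) \<longlonglongrightarrow> 0"
      by (rule tendsto_sandwich[OF _ _ tendsto_const er]) (use that in \<open>simp_all add: less_imp_le\<close>)
    then show ?thesis by (subst tendsto_dist_iff)
  qed
  have Xlim: "(\<lambda>n. X (r n) $ i) \<longlonglongrightarrow> x" for i by (rule squeeze) (rule X)
  have ulim: "(\<lambda>n. u (r n)) \<longlonglongrightarrow> x" by (rule squeeze) (rule u)
  \<comment> \<open>The normals to K carry no a priori bound; they converge because the residual,
    the slopes and p do.\<close>
  define \<omega>' where "\<omega>' = - (\<Sum>i\<in>UNIV. W' $ i) - p'"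
  have "(\<lambda>n. (\<Sum>i\<in>UNIV. W (r n) $ i) + \<omega> (r n) + p (r n)) \<longlonglongrightarrow> 0"
    by (rule Lim_null_comparison[OF _ er]) (use res in \<open>simp add: less_imp_le\<close>)
  then have "(\<lambda>n. ((\<Sum>i\<in>UNIV. W (r n) $ i) + \<omega> (r n) + p (r n)) - (\<Sum>i\<in>UNIV. W (r n) $ i) - p (r n))
      \<longlonglongrightarrow> 0 - (\<Sum>i\<in>UNIV. W' $ i) - p'"
    by (intro tendsto_diff tendsto_sum Wlimi pr)
  then have "(\<lambda>n. \<omega> (r n)) \<longlonglongrightarrow> \<omega>'" by (simp add: \<omega>'_def)
  with u(1,3) ulim have \<omega>': "\<omega>' \<in> limiting_normal_cone x K"
    by (intro limiting_normal_coneI[of "\<lambda>n. u (r n)" K "\<lambda>n. \<omega> (r n)"]) auto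
  \<comment> \<open>A positive weight allows rescaling the normal to vertical part -1; for weight 0
    the Lipschitz bound passes to the limit and kills the slope.\<close>
  have "\<exists>v. v \<in> limiting_subdiff (\<lambda>z. f z $ i) x \<and> W' $ i = a' $ i *\<^sub>R v" for i
  proof (cases "a' $ i = 0")
    case True
    obtain v where v: "v \<in> limiting_subdiff (\<lambda>z. f z $ i) x"
      using limiting_subdiff_nonempty[OF locally_lipschitz_component[OF f]] by blast
    have "norm (W' $ i) \<le> L * a' $ i"
      by (rule LIMSEQ_le[OF tendsto_norm[OF Wlimi] tendsto_mult_left[OF ar]]) (use Wbd rn in blast)
    then show ?thesis using v True by auto
  next
    case False
    then have pos: "a' $ i > 0" using a'0[of i] by simp
    have fl: "(\<lambda>n. f (X (r n) $ i) $ i) \<longlonglongrightarrow> f x $ i"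
    proof -
      have "isCont f x"
        using locally_lipschitz_continuous_on[OF f, of UNIV] by (simp add: continuous_on_eq_continuous_at)
      then show ?thesis using Xlim by (intro tendsto_vec_nth) (rule isCont_tendsto_compose)
    qed
    have "(W' $ i, - (a' $ i)) \<in> limiting_normal_cone (x, f x $ i) (?E i)"
    proof (rule limiting_normal_coneI)
      show "(X (r n) $ i, f (X (r n) $ i) $ i) \<in> ?E i" for n by (simp add: epigraph_def)
      show "(W (r n) $ i, - (a (r n) $ i)) \<in> regular_normal_cone (X (r n) $ i, f (X (r n) $ i) $ i) (?E i)" for n
        by (rule W)
      show "(\<lambda>n. (X (r n) $ i, f (X (r n) $ i) $ i)) \<longlonglongrightarrow> (x, f x $ i)"
        by (intro tendsto_Pair Xlim fl)
      show "(\<lambda>n. (W (r n) $ i, - (a (r n) $ i))) \<longlonglongrightarrow> (W' $ i, - (a' $ i))"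
        by (intro tendsto_Pair tendsto_minus Wlimi ar)
    qed
    then have "(1 / a' $ i) *\<^sub>R (W' $ i, - (a' $ i)) \<in> limiting_normal_cone (x, f x $ i) (?E i)"
      using pos by (intro limiting_normal_cone_scaleR) auto
    then have "(1 / a' $ i) *\<^sub>R W' $ i \<in> limiting_subdiff (\<lambda>z. f z $ i) x"
      using pos by (simp add: limiting_subdiff_def)
    moreover have "W' $ i = a' $ i *\<^sub>R ((1 / a' $ i) *\<^sub>R W' $ i)" using pos by simp
    ultimately show ?thesis by blast
  qed
  then obtain v where v: "\<And>i. v i \<in> limiting_subdiff (\<lambda>z. f z $ i) x" "\<And>i. W' $ i = a' $ i *\<^sub>R v i"
    by metis
  have "(\<Sum>i\<in>UNIV. a' $ i *\<^sub>R v i) + \<omega>' + p' = 0" by (simp add: \<omega>'_def flip: v(2))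
  moreover have "0 \<le> a'" using a'0 by (simp add: less_eq_vec_def)
  ultimately show ?thesis using v(1) \<omega>' by blast
qed

section \<open>Almost critical points and tangency points in the sublevel set\<close>

lemma bounded_subprobability: "bounded {a :: real^'s. 0 \<le> a \<and> (\<Sum>i\<in>UNIV. a $ i) \<le> 1}"
proof (rule boundedI)
  fix a :: "real^'s" assume a: "a \<in> {a. 0 \<le> a \<and> (\<Sum>i\<in>UNIV. a $ i) \<le> 1}"
  have "norm a \<le> (\<Sum>i\<in>UNIV. \<bar>a $ i\<bar>)" by (rule norm_le_l1_cart)
  also have "\<dots> = (\<Sum>i\<in>UNIV. a $ i)" using a by (intro sum.cong) (auto simp: less_eq_vec_def)
  finally show "norm a \<le> 1" using a by simp
qed

text \<open>\<open>cInf_greatest\<close> asks for a nonempty set, so even nonnegativity takes an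
  admissible choice as a witness.\<close>

lemma rabier_nonneg_le:
  assumes "\<And>i. v i \<in> limiting_subdiff (\<lambda>z. f z $ i) x" "\<omega> \<in> limiting_normal_cone x K"
    "0 \<le> a" "(\<Sum>i\<in>UNIV. a $ i) = 1"
  shows "0 \<le> rabier f K x" "rabier f K x \<le> norm ((\<Sum>i\<in>UNIV. a $ i *\<^sub>R v i) + \<omega>)"
proof -
  let ?A = "{norm ((\<Sum>i\<in>UNIV. (\<alpha> $ i) *\<^sub>R v i) + \<omega>) | (\<alpha> :: real^_) v \<omega>.
            (\<forall>i. v i \<in> limiting_subdiff (\<lambda>z. f z $ i) x) \<and>
            \<omega> \<in> limiting_normal_cone x K \<and>
            0 \<le> \<alpha> \<and> (\<Sum>i\<in>UNIV. \<alpha> $ i) = 1}"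
  have mem: "norm ((\<Sum>i\<in>UNIV. a $ i *\<^sub>R v i) + \<omega>) \<in> ?A" using assms by blast
  then show "0 \<le> rabier f K x" unfolding rabier_def by (intro cInf_greatest) auto
  have "bdd_below ?A" by (intro bdd_belowI[of _ 0]) auto
  with mem show "rabier f K x \<le> norm ((\<Sum>i\<in>UNIV. a $ i *\<^sub>R v i) + \<omega>)"
    unfolding rabier_def by (rule cInf_lower)
qed

text \<open>With the centre x fixed and errors 1/(n+1), a limit of the multipliers balances the
  gradient exactly: a convex combination of subgradients plus a normal equals - G x.\<close>

lemma rabier_le_gradient:
  fixes f :: "'a::euclidean_space \<Rightarrow> real^'s"
  assumes f: "locally_lipschitz f" and K: "closed K" "x \<in> K"
    and q: "\<And>y. (q has_derivative (\<lambda>h. G y \<bullet> h)) (at y)" and G: "isCont G x"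
    and r: "r > 0"
    and min: "\<And>y. y \<in> K \<Longrightarrow> dist x y \<le> r \<Longrightarrow> vmax (f x - c) + q x \<le> vmax (f y - c) + q y"
  shows "0 \<le> rabier f K x" "rabier f K x \<le> norm (G x)"
proof -
  have "\<exists>a. (\<Sum>i\<in>UNIV. a $ i) = 1 \<and> approx_multiplier f K x a (G x) (inverse (real (Suc n)))" for n
    using fuzzy_multiplier_rule[OF f K q G r min] by simp
  then obtain a where a: "\<And>n. (\<Sum>i\<in>UNIV. a n $ i) = 1"
    "\<And>n. approx_multiplier f K x (a n) (G x) (inverse (real (Suc n)))" by metis
  then have "bounded (range a)"
    by (intro bounded_subset[OF bounded_subprobability]) (auto simp: approx_multiplier_def)
  then obtain a' s where s: "strict_mono s" "(a \<circ> s) \<longlonglongrightarrow> a'"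
    using bounded_imp_convergent_subsequence by blast
  have "(\<lambda>n. inverse (real (Suc (s n)))) \<longlonglongrightarrow> 0"
    using LIMSEQ_inverse_real_of_nat filterlim_subseq[OF s(1)] by (rule filterlim_compose)
  from approx_multiplier_limit[OF f a(2) this s(2)[unfolded o_def] tendsto_const]
  obtain v \<omega> where v: "\<And>i. v i \<in> limiting_subdiff (\<lambda>z. f z $ i) x" "\<omega> \<in> limiting_normal_cone x K"
     "0 \<le> a'" and eq: "(\<Sum>i\<in>UNIV. a' $ i *\<^sub>R v i) + \<omega> + G x = 0" by blast
  have "(\<lambda>n. \<Sum>i\<in>UNIV. (a \<circ> s) n $ i) \<longlonglongrightarrow> (\<Sum>i\<in>UNIV. a' $ i)"
    by (intro tendsto_sum tendsto_vec_nth s)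
  then have sum: "(\<Sum>i\<in>UNIV. a' $ i) = 1" using a(1) by (simp add: LIMSEQ_const_iff)
  have "norm ((\<Sum>i\<in>UNIV. a' $ i *\<^sub>R v i) + \<omega>) = norm (G x)"
    using eq by (metis add_eq_0_iff2 norm_minus_cancel)
  then show "0 \<le> rabier f K x" "rabier f K x \<le> norm (G x)"
    using rabier_nonneg_le[OF v sum] by auto
qed

text \<open>A quadratic form of Ekeland's variational principle, started at a point of the sublevel set
  whose value is almost the infimum over all points of at least half its norm.\<close>

lemma exists_almost_critical:
  fixes f :: "'a::euclidean_space \<Rightarrow> real^'s"
  assumes f: "locally_lipschitz f" and K: "closed K"
    and unbdd: "\<And>R. \<exists>x\<in>K. f x \<le> c \<and> R \<le> norm x"
    and below: "\<And>x. x \<in> K \<Longrightarrow> f x \<le> c \<Longrightarrow> m \<le> vmax (f x - c)"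
    and e: "e > 0"
  shows "\<exists>x\<in>K. f x \<le> c \<and> R \<le> norm x \<and> 0 \<le> rabier f K x \<and> norm x * rabier f K x \<le> e"
proof -
  define F where "F x = vmax (f x - c)" for x
  \<comment> \<open>The final bound is (3 l) * (2 b l) with b equal to 4 \<epsilon> over the square
    of l, that is 24 \<epsilon>.\<close>
  define \<epsilon> where "\<epsilon> = e / 24"
  have \<epsilon>: "\<epsilon> > 0" using e by (simp add: \<epsilon>_def)
  have F0: "F x \<le> 0 \<longleftrightarrow> f x \<le> c" for x by (simp add: F_def vmax_le_iff less_eq_vec_def)
  define S where "S t = {x \<in> K. f x \<le> c \<and> t \<le> norm x}" for t
  have S: "S t \<noteq> {}" for t using unbdd[of t] by (auto simp: S_def)
  have bb: "bdd_below (F ` S t)" for t using below by (intro bdd_belowI[of _ m]) (auto simp: S_def F_def)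
  \<comment> \<open>M is nondecreasing and bounded above by 0, so beyond some \<open>t1\<close> it
    stays within \<epsilon> of its supremum. A nearly optimal point of \<open>S (2 * t)\<close> is
    then optimal up to 2 \<epsilon> on the larger set \<open>S t\<close>, which leaves room for a
    ball around it.\<close>
  define M where "M t = Inf (F ` S t)" for t
  have "M t \<le> 0" for t
  proof -
    obtain x where x: "x \<in> S t" using S by blast
    then have "M t \<le> F x" unfolding M_def using bb by (intro cInf_lower) auto
    then show ?thesis using x F0[of x] by (simp add: S_def)
  qed
  then have ba: "bdd_above (range M)" by (intro bdd_aboveI[of _ 0]) auto
  have mono: "M t \<le> M t'" if "t \<le> t'" for t t'
    unfolding M_def using that bb S by (intro cInf_superset_mono) (auto simp: S_def)
  obtain t1 where t1: "Sup (range M) - \<epsilon> < M t1"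
    using less_cSupD[of "range M" "Sup (range M) - \<epsilon>"] \<epsilon> by auto
  define t where "t = Max {t1, R, 1}"
  have t: "t1 \<le> t" "R \<le> t" "t \<ge> 1" by (auto simp: t_def)
  have "Inf (F ` S (2 * t)) < Sup (range M) + \<epsilon>"
    using cSup_upper[OF _ ba, of "M (2 * t)"] \<epsilon> by (auto simp: M_def)
  then obtain x where x: "x \<in> S (2 * t)" "F x < Sup (range M) + \<epsilon>"
    using cInf_lessD[of "F ` S (2 * t)"] S by blast
  have almost: "F x \<le> F z + 2 * \<epsilon>" if "z \<in> S t" for z
  proof -
    have "M t \<le> F z" unfolding M_def using bb that by (intro cInf_lower) auto
    then show ?thesis using x(2) t1 mono[OF t(1)] by linarith
  qed
  \<comment> \<open>In the ball of this radius about x all norms lie between l and 3 l, so its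
    points of the sublevel set belong to \<open>S t\<close>.\<close>
  define l where "l = norm x / 2"
  have l: "l \<ge> t" "l > 0" using x(1) t by (auto simp: S_def l_def)
  \<comment> \<open>On the boundary of the ball q equals 4 \<epsilon>, more than the 2 \<epsilon>
    that F can gain, so the minimiser is interior. The gradient of q is at most 2 b l = 8 \<epsilon>
    / l, which decays like the inverse of \<open>norm x\<close>.\<close>
  define b where "b = 4 * \<epsilon> / l\<^sup>2"
  have b: "b > 0" using \<epsilon> l by (simp add: b_def)
  define q where "q y = b * (norm (y - x))\<^sup>2" for y
  have "\<exists>y\<in>K \<inter> cball x l. \<forall>z\<in>K \<inter> cball x l. F y + q y \<le> F z + q z"
  proof (rule continuous_attains_inf)
    show "compact (K \<inter> cball x l)" using K by (intro closed_Int_compact) auto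
    show "K \<inter> cball x l \<noteq> {}" using x(1) l by (auto simp: S_def)
    show "continuous_on (K \<inter> cball x l) (\<lambda>z. F z + q z)" unfolding F_def q_def
      by (intro continuous_intros continuous_on_compose2[OF continuous_on_vmax[of UNIV]]
          locally_lipschitz_continuous_on f) auto
  qed
  then obtain y where y: "y \<in> K" "dist x y \<le> l"
    and ymin: "\<And>z. z \<in> K \<Longrightarrow> dist x z \<le> l \<Longrightarrow> F y + q y \<le> F z + q z" by auto
  have Fyx: "F y + q y \<le> F x" using ymin[of x] x(1) l by (simp add: S_def q_def)
  have "q y \<ge> 0" using b by (simp add: q_def)
  \<comment> \<open>The minimisation ran over K alone; descent in F keeps y in the sublevel
    set.\<close>
  then have yc: "f y \<le> c" using Fyx x(1) F0[of y] F0[of x] by (simp add: S_def)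
  have tri: "norm x \<le> norm y + dist x y" "norm y \<le> norm x + dist x y"
    using norm_triangle_ineq2[of x y] norm_triangle_ineq2[of y x] by (simp_all add: dist_norm norm_minus_commute)
  have ny: "l \<le> norm y" "norm y \<le> 3 * l" using tri y(2) by (simp_all add: l_def)
  have "y \<in> S t" using y(1) yc ny l by (simp add: S_def)
  then have "q y \<le> 2 * \<epsilon>" using almost[of y] Fyx by simp
  then have "(norm (y - x))\<^sup>2 \<le> l\<^sup>2 / 2" using \<epsilon> l by (simp add: q_def b_def field_simps)
  then have "(norm (y - x))\<^sup>2 < l\<^sup>2" using zero_less_power[OF l(2), of 2] by linarith
  then have int: "dist x y < l" using l by (simp add: dist_norm norm_minus_commute power2_less_imp_less)
  define G where "G z = (2 * b) *\<^sub>R (z - x)" for z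
  have qd: "(q has_derivative (\<lambda>h. G z \<bullet> h)) (at z)" for z
    unfolding q_def power2_norm_eq_inner G_def
    by (auto intro!: derivative_eq_intros simp: inner_commute algebra_simps fun_eq_iff)
  have Gc: "isCont G y" unfolding G_def by (intro continuous_intros)
  have locmin: "vmax (f y - c) + q y \<le> vmax (f z - c) + q z" if "z \<in> K" "dist y z \<le> l - dist x y" for z
    using ymin[OF that(1)] that(2) dist_triangle[of x z y] by (simp add: F_def)
  have "l - dist x y > 0" using int by simp
  note rab = rabier_le_gradient[OF f K y(1) qd Gc this locmin]
  have "norm (G y) \<le> 2 * b * l" using b int by (simp add: G_def dist_norm norm_minus_commute)
  then have "norm y * rabier f K y \<le> (3 * l) * (2 * b * l)"
    using ny l rab by (intro mult_mono) auto
  also have "\<dots> = e" using l by (simp add: b_def \<epsilon>_def power2_eq_square)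
  finally have "norm y * rabier f K y \<le> e" .
  moreover have "R \<le> norm y" using ny l t by linarith
  ultimately show ?thesis using y(1) yc rab by blast
qed

text \<open>Minimising the maximum of the components over a sphere, with the sphere treated by a
  quadratic penalty. The penalty multipliers may be unbounded, hence the normalisation.\<close>

lemma tangency_on_sphere:
  fixes f :: "'a::euclidean_space \<Rightarrow> real^'s"
  assumes f: "locally_lipschitz f" and K: "closed K" and z: "z \<in> K" "f z \<le> c"
  shows "\<exists>x\<in>tangency_variety f K. f x \<le> c \<and> norm x = norm z"
proof -
  define F where "F x = vmax (f x - c)" for x
  have F0: "F x \<le> 0 \<longleftrightarrow> f x \<le> c" for x by (simp add: F_def vmax_le_iff less_eq_vec_def)
  have Fc: "continuous_on A F" for A unfolding F_def
    by (intro continuous_intros continuous_on_compose2[OF continuous_on_vmax[of UNIV]]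
          locally_lipschitz_continuous_on f) auto
  define h where "h x = (norm x)\<^sup>2 - (norm z)\<^sup>2" for x :: 'a
  \<comment> \<open>The extra unit of radius puts the sphere of radius \<open>norm z\<close> into
    the interior of the ball, so minimisers approaching that sphere eventually minimise over all
    nearby points of K.\<close>
  define B where "B = K \<inter> cball 0 (norm z + 1)"
  have B: "compact B" "z \<in> B" using K z by (auto simp: B_def intro: closed_Int_compact)
  have "\<exists>x\<in>B. \<forall>y\<in>B. F x + real n * (h x)\<^sup>2 \<le> F y + real n * (h y)\<^sup>2" for n
    unfolding h_def using B by (intro continuous_attains_inf continuous_intros Fc) auto
  then obtain X where X: "\<And>n. X n \<in> B"
    and Xmin: "\<And>n y. y \<in> B \<Longrightarrow> F (X n) + real n * (h (X n))\<^sup>2 \<le> F y + real n * (h y)\<^sup>2" by metis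
  have Fz: "F z \<le> 0" using z F0 by simp
  \<comment> \<open>Comparison with z, where the penalty vanishes, keeps X n in the sublevel set
    and, with the lower bound of F on \<open>B\<close>, bounds the penalty.\<close>
  have FX: "F (X n) + real n * (h (X n))\<^sup>2 \<le> 0" for n using Xmin[OF B(2), of n] Fz by (simp add: h_def)
  obtain m where m: "\<And>x. x \<in> B \<Longrightarrow> m \<le> F x"
    using continuous_attains_inf[OF B(1) _ Fc] B(2) by blast
  obtain x s where x: "x \<in> B" "strict_mono s" "(X \<circ> s) \<longlonglongrightarrow> x"
    using B(1) X unfolding compact_def by metis
  then have Xs: "(\<lambda>n. X (s n)) \<longlonglongrightarrow> x" by (simp add: o_def)
  have contF: "isCont F x" using Fc[of UNIV] by (simp add: continuous_on_eq_continuous_at)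
  have conth: "isCont h w" for w unfolding h_def by (intro continuous_intros)
  have "F x \<le> 0"
  proof (rule LIMSEQ_le_const2)
    show "(\<lambda>n. F (X (s n))) \<longlonglongrightarrow> F x" using contF Xs by (rule isCont_tendsto_compose)
    have "F (X n) \<le> 0" for n
    proof -
      have "0 \<le> real n * (h (X n))\<^sup>2" by simp
      then show ?thesis using FX[of n] by linarith
    qed
    then show "\<exists>N. \<forall>n\<ge>N. F (X (s n)) \<le> 0" by blast
  qed
  then have xc: "f x \<le> c" by (simp add: F0)
  have "(\<lambda>n. (h (X n))\<^sup>2) \<longlonglongrightarrow> 0"
  proof (rule tendsto_sandwich[of "\<lambda>_. 0" _ _ "\<lambda>n. - m / real n"])
    show "\<forall>\<^sub>F n in sequentially. (h (X n))\<^sup>2 \<le> - m / real n"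
      using eventually_gt_at_top[of 0]
    proof eventually_elim
      case (elim n)
      have "real n * (h (X n))\<^sup>2 \<le> - m" using FX[of n] m[OF X[of n]] by linarith
      then show ?case using elim by (simp add: field_simps)
    qed
    show "(\<lambda>n. - m / real n) \<longlonglongrightarrow> 0" by (rule lim_const_over_n)
  qed auto
  then have "(\<lambda>n. (h (X (s n)))\<^sup>2) \<longlonglongrightarrow> 0" using filterlim_subseq[OF x(2)] by (rule filterlim_compose)
  moreover have "(\<lambda>n. (h (X (s n)))\<^sup>2) \<longlonglongrightarrow> (h x)\<^sup>2"
    by (intro tendsto_power isCont_tendsto_compose[OF conth] Xs)
  ultimately have "h x = 0" using LIMSEQ_unique by fastforce
  then have nx: "norm x = norm z" by (simp add: h_def)
  \<comment> \<open>The penalty has gradient \<open>M n *\<^sub>R X n\<close> at X n, because h has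
    gradient 2 X n there. The factor t makes the total weight t and the modulus of t M add up to 1,
    as \<open>tangency_variety\<close> demands.\<close>
  define M where "M n = 4 * real n * h (X n)" for n
  define t where "t n = 1 / (1 + \<bar>M n\<bar>)" for n
  have t: "0 < t n" "t n \<le> 1" for n by (auto simp: t_def)
  have "\<forall>\<^sub>F n in sequentially. norm (X (s n)) < norm z + 1"
    using tendsto_norm[OF Xs] nx by (intro order_tendstoD) auto
  then obtain n0 where n0: "\<And>n. n \<ge> n0 \<Longrightarrow> norm (X (s n)) < norm z + 1"
    by (auto simp: eventually_sequentially)
  define S where "S n = s (n + n0)" for n
  have S: "filterlim S at_top sequentially" unfolding S_def
    by (intro filterlim_compose[OF filterlim_subseq[OF x(2)]] filterlim_add_const_nat_at_top)
  have XS: "(\<lambda>n. X (S n)) \<longlonglongrightarrow> x" unfolding S_def using Xs by (rule LIMSEQ_ignore_initial_segment)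
  \<comment> \<open>The second term pays for moving the centre from \<open>X (S n)\<close> to its
    limit x.\<close>
  define e where "e n = inverse (real (Suc n)) + dist (X (S n)) x" for n
  have "\<exists>a. (\<Sum>i\<in>UNIV. a $ i) = 1 \<and> approx_multiplier f K x (t (S n) *\<^sub>R a) (t (S n) *\<^sub>R M (S n) *\<^sub>R X (S n)) (e n)" for n
  proof -
    let ?k = "S n"
    let ?q = "\<lambda>y. real ?k * (h y)\<^sup>2"
    let ?G = "\<lambda>y. (4 * real ?k * h y) *\<^sub>R y"
    have "\<exists>a. (\<Sum>i\<in>UNIV. a $ i) = 1 \<and> approx_multiplier f K (X ?k) a (?G (X ?k)) (inverse (real (Suc n)))"
    proof (rule fuzzy_multiplier_rule[OF f K])
      show "X ?k \<in> K" using X[of ?k] by (simp add: B_def)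
      show "(?q has_derivative (\<lambda>y. ?G w \<bullet> y)) (at w)" for w
        unfolding h_def power2_norm_eq_inner
        by (auto intro!: derivative_eq_intros simp: inner_commute algebra_simps fun_eq_iff)
      show "isCont ?G (X ?k)" by (intro continuous_intros conth)
      show "norm z + 1 - norm (X ?k) > 0" using n0[of "n + n0"] by (simp add: S_def)
      show "vmax (f (X ?k) - c) + ?q (X ?k) \<le> vmax (f y - c) + ?q y"
        if "y \<in> K" "dist (X ?k) y \<le> norm z + 1 - norm (X ?k)" for y
      proof -
        have "norm y \<le> norm (X ?k) + dist (X ?k) y"
          using norm_triangle_ineq2[of y "X ?k"] by (simp add: dist_norm norm_minus_commute)
        then have "y \<in> B" using that by (simp add: B_def)
        from Xmin[OF this] show ?thesis by (simp add: F_def)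
      qed
    qed simp
    then obtain a where a: "(\<Sum>i\<in>UNIV. a $ i) = 1"
      "approx_multiplier f K (X ?k) a (M ?k *\<^sub>R X ?k) (inverse (real (Suc n)))" by (auto simp: M_def)
    have "approx_multiplier f K x a (M ?k *\<^sub>R X ?k) (e n)"
      by (rule approx_multiplier_move[OF a(2)]) (simp add: e_def)
    then show ?thesis using a(1) t[of ?k] by (blast intro: approx_multiplier_scaleR less_imp_le)
  qed
  then obtain a where a: "\<And>n. (\<Sum>i\<in>UNIV. a n $ i) = 1"
    and am: "\<And>n. approx_multiplier f K x (t (S n) *\<^sub>R a n) (t (S n) *\<^sub>R M (S n) *\<^sub>R X (S n)) (e n)" by metis
  define A where "A n = t (S n) *\<^sub>R a n" for n
  define \<mu> where "\<mu> n = t (S n) * M (S n)" for n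
  have sumA: "(\<Sum>i\<in>UNIV. A n $ i) = t (S n)" for n
    using a[of n] by (simp add: A_def flip: sum_distrib_left)
  have tot: "(\<Sum>i\<in>UNIV. A n $ i) + \<bar>\<mu> n\<bar> = 1" for n
    unfolding sumA \<mu>_def by (simp add: t_def abs_mult field_simps)
  have "bounded (range A)"
    by (intro bounded_subset[OF bounded_subprobability])
      (use am t sumA in \<open>auto simp: approx_multiplier_def A_def\<close>)
  moreover have "bounded (range \<mu>)"
  proof (rule boundedI)
    fix w assume "w \<in> range \<mu>"
    then obtain n where "w = \<mu> n" by blast
    then show "norm w \<le> 1" using tot[of n] sumA[of n] t[of "S n"] by simp
  qed
  \<comment> \<open>Weights and \<mu> are treated as a pair so that one subsequence serves
    both.\<close>
  ultimately have "bounded (range A \<times> range \<mu>)" by (rule bounded_Times)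
  then have "bounded (range (\<lambda>n. (A n, \<mu> n)))" by (rule bounded_subset) auto
  then obtain l r where r: "strict_mono r" "((\<lambda>n. (A n, \<mu> n)) \<circ> r) \<longlonglongrightarrow> l"
    using bounded_imp_convergent_subsequence by blast
  obtain a' \<mu>' where l: "l = (a', \<mu>')" by (cases l)
  have Alim: "(\<lambda>n. A (r n)) \<longlonglongrightarrow> a'" using tendsto_fst[OF r(2)] by (simp add: l o_def)
  have \<mu>lim: "(\<lambda>n. \<mu> (r n)) \<longlonglongrightarrow> \<mu>'" using tendsto_snd[OF r(2)] by (simp add: l o_def)
  have sub: "filterlim r at_top sequentially" by (rule filterlim_subseq[OF r(1)])
  have "e \<longlonglongrightarrow> 0 + 0" unfolding e_def
    using XS by (intro tendsto_add LIMSEQ_inverse_real_of_nat) (simp flip: tendsto_dist_iff)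
  then have elim: "(\<lambda>n. e (r n)) \<longlonglongrightarrow> 0" using sub by (simp add: filterlim_compose)
  have plim: "(\<lambda>n. \<mu> (r n) *\<^sub>R X (S (r n))) \<longlonglongrightarrow> \<mu>' *\<^sub>R x"
    by (intro tendsto_scaleR \<mu>lim filterlim_compose[OF XS sub])
  have "approx_multiplier f K x (A (r n)) (\<mu> (r n) *\<^sub>R X (S (r n))) (e (r n))" for n
    using am[of "r n"] by (simp add: A_def \<mu>_def)
  from approx_multiplier_limit[OF f this elim Alim plim]
  obtain v \<omega> where v: "\<And>i. v i \<in> limiting_subdiff (\<lambda>z. f z $ i) x" "\<omega> \<in> limiting_normal_cone x K"
     "0 \<le> a'" and eq: "(\<Sum>i\<in>UNIV. a' $ i *\<^sub>R v i) + \<omega> + \<mu>' *\<^sub>R x = 0" by blast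
  have "(\<lambda>n. (\<Sum>i\<in>UNIV. A (r n) $ i) + \<bar>\<mu> (r n)\<bar>) \<longlonglongrightarrow> (\<Sum>i\<in>UNIV. a' $ i) + \<bar>\<mu>'\<bar>"
    by (intro tendsto_intros Alim \<mu>lim)
  then have "(\<Sum>i\<in>UNIV. a' $ i) + \<bar>\<mu>'\<bar> = 1" by (simp add: tot LIMSEQ_const_iff)
  moreover have "0 = (\<Sum>i\<in>UNIV. a' $ i *\<^sub>R v i) + \<mu>' *\<^sub>R x + \<omega>" using eq by (simp add: algebra_simps)
  moreover have "x \<in> K" using x(1) by (simp add: B_def)
  ultimately have "x \<in> tangency_variety f K" using v unfolding tangency_variety_def by blast
  then show ?thesis using xc nx by blast
qed

section \<open>The four conditions and boundedness of the sublevel set\<close>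

theorem theorem4p1:
  fixes f :: "real^'n \<Rightarrow> real^'s" and K :: "(real^'n) set"
    and I :: "'s set" and x0 :: "real^'n"
  assumes "locally_lipschitz f"
    and "K \<noteq> {}" and "closed K"
    and "I \<noteq> {}" and "x0 \<in> K"
    and "weakly_section_bounded_below f K I x0"
  shows "(proper_at_sublevel f K I (f x0) \<longleftrightarrow> palais_smale f K I (f x0)) \<and>
    (palais_smale f K I (f x0) \<longleftrightarrow> weak_palais_smale f K I (f x0)) \<and>
    (weak_palais_smale f K I (f x0) \<longleftrightarrow> M_tame f K I (f x0)) \<and>
    (proper_at_sublevel f K I (f x0) \<or> palais_smale f K I (f x0) \<or>
       weak_palais_smale f K I (f x0) \<or> M_tame f K I (f x0) \<longrightarrow>
     compact (sublevel_set f K (f x0)) \<and> compact (section_at (f ` K) (f x0)))"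
proof -
  let ?c = "f x0"
  let ?S = "sublevel_set f K ?c"
  note f = assms(1) and K = assms(3)
  have inS: "x \<in> ?S \<longleftrightarrow> x \<in> K \<and> f x \<le> ?c" for x by (simp add: sublevel_set_def)
  obtain b where b: "\<And>x i. x \<in> ?S \<Longrightarrow> i \<in> I \<Longrightarrow> b $ i \<le> f x $ i"
  proof -
    obtain b where b: "{sub_vec I (f x) | x. x \<in> ?S} \<subseteq> {b + r | r. r \<in> coord_space I \<and> 0 \<le> r}"
      using assms(6) unfolding weakly_section_bounded_below_def by blast
    have "b $ i \<le> f x $ i" if "x \<in> ?S" "i \<in> I" for x i
    proof -
      have "sub_vec I (f x) \<in> {b + r | r. r \<in> coord_space I \<and> 0 \<le> r}"
        by (rule subsetD[OF b]) (use that(1) in auto)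
      then obtain r where "sub_vec I (f x) = b + r" "0 \<le> r" by blast
      then have "sub_vec I (f x) $ i = b $ i + r $ i" "0 \<le> r $ i" by (auto simp: less_eq_vec_def)
      then show ?thesis using that(2) by (simp add: sub_vec_def)
    qed
    then show ?thesis by (rule that)
  qed
  have bdI: "norm (sub_vec I (f x)) \<le> (\<Sum>i\<in>UNIV. \<bar>b $ i\<bar> + \<bar>?c $ i\<bar>)" if "x \<in> ?S" for x
  proof -
    have "norm (sub_vec I (f x)) \<le> (\<Sum>i\<in>UNIV. \<bar>sub_vec I (f x) $ i\<bar>)" by (rule norm_le_l1_cart)
    also have "\<dots> \<le> (\<Sum>i\<in>UNIV. \<bar>b $ i\<bar> + \<bar>?c $ i\<bar>)"
    proof (rule sum_mono)
      fix i
      have "f x $ i \<le> ?c $ i" using that by (simp add: inS less_eq_vec_def)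
      then show "\<bar>sub_vec I (f x) $ i\<bar> \<le> \<bar>b $ i\<bar> + \<bar>?c $ i\<bar>"
        using b[OF that, of i] by (auto simp: sub_vec_def)
    qed
    finally show ?thesis .
  qed
  have subseq: "\<exists>r y. strict_mono r \<and> y \<in> coord_space I \<and> (\<lambda>k. sub_vec I (f (x (r k)))) \<longlonglongrightarrow> y"
    if "\<And>k. x k \<in> ?S" for x :: "nat \<Rightarrow> real^'n"
  proof -
    have "bounded (range (\<lambda>k. sub_vec I (f (x k))))" using bdI that by (auto intro!: boundedI)
    then obtain r y where r: "strict_mono r" "((\<lambda>k. sub_vec I (f (x k))) \<circ> r) \<longlonglongrightarrow> y"
      using bounded_imp_convergent_subsequence by blast
    have "y $ i = 0" if "i \<notin> I" for i
      using tendsto_vec_nth[OF r(2), of i] that by (simp add: sub_vec_def LIMSEQ_const_iff)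
    then show ?thesis using r by (auto simp: coord_space_def o_def)
  qed
  have closedS: "closed ?S"
  proof -
    have "?S = (\<Inter>i. K \<inter> {x. f x $ i \<le> ?c $ i})" by (auto simp: sublevel_set_def less_eq_vec_def)
    moreover have "closed {x. f x $ i \<le> ?c $ i}" for i
      using locally_lipschitz_continuous_on[OF f, of UNIV] by (intro closed_Collect_le continuous_intros)
    ultimately show ?thesis using K by (simp add: closed_Int closed_INT)
  qed
  have unb: "\<exists>x\<in>?S. R \<le> norm x" if "\<not> bounded ?S" for R
    using that unfolding bounded_iff by (meson linear)
  have norm_top: "filterlim (\<lambda>k. norm (x k)) at_top sequentially" if "\<And>k. real k \<le> norm (x k)"
    for x :: "nat \<Rightarrow> real^'n"
    by (rule filterlim_at_top_mono[OF filterlim_real_sequentially]) (use that in auto)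
  have no_seq: False if seq: "bounded ?S" "\<And>k. x k \<in> ?S" "filterlim (\<lambda>k. norm (x k)) at_top sequentially"
    for x :: "nat \<Rightarrow> real^'n"
  proof -
    obtain B where B: "\<And>k. norm (x k) \<le> B" using seq(1,2) by (auto simp: bounded_iff)
    have "\<forall>\<^sub>F k in sequentially. B < norm (x k)" using seq(3) by (simp add: filterlim_at_top_dense)
    then obtain k where "B < norm (x k)" using eventually_happens'[OF sequentially_bot] by blast
    then show False using B[of k] by linarith
  qed
  have proper: "proper_at_sublevel f K I ?c \<longleftrightarrow> bounded ?S"
  proof
    assume p: "proper_at_sublevel f K I ?c"
    show "bounded ?S"
    proof (rule ccontr)
      assume "\<not> bounded ?S"
      then have "\<exists>x. x \<in> ?S \<and> real k \<le> norm x" for k using unb by blast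
      then obtain x where x: "\<And>k. x k \<in> ?S" "\<And>k. real k \<le> norm (x k)" by metis
      have "filterlim (\<lambda>k. norm (sub_vec I (f (x k)))) at_top sequentially"
        using p x(1) norm_top[OF x(2)] unfolding proper_at_sublevel_def by (auto simp: inS)
      then have "\<forall>\<^sub>F k in sequentially. (\<Sum>i\<in>UNIV. \<bar>b $ i\<bar> + \<bar>?c $ i\<bar>) < norm (sub_vec I (f (x k)))"
        by (simp add: filterlim_at_top_dense)
      then obtain k where "(\<Sum>i\<in>UNIV. \<bar>b $ i\<bar> + \<bar>?c $ i\<bar>) < norm (sub_vec I (f (x k)))"
        using eventually_happens'[OF sequentially_bot] by blast
      then show False using bdI[OF x(1), of k] by linarith
    qed
  next
    assume "bounded ?S"
    then show "proper_at_sublevel f K I ?c"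
      unfolding proper_at_sublevel_def using no_seq inS by blast
  qed
  have M: "M_tame f K I ?c \<longleftrightarrow> bounded ?S"
  proof
    assume p: "M_tame f K I ?c"
    show "bounded ?S"
    proof (rule ccontr)
      assume nb: "\<not> bounded ?S"
      have "\<exists>x\<in>tangency_variety f K. f x \<le> ?c \<and> real k \<le> norm x" for k
      proof -
        obtain z where "z \<in> ?S" "real k \<le> norm z" using unb[OF nb] by blast
        \<comment> \<open>The tangency point has the norm of z, so it is just as far out.\<close>
        then show ?thesis using tangency_on_sphere[OF f K, of z ?c] by (auto simp: inS)
      qed
      then obtain x where x: "\<And>k. x k \<in> tangency_variety f K" "\<And>k. f (x k) \<le> ?c" "\<And>k. real k \<le> norm (x k)"
        by metis
      have "x k \<in> ?S" for k using x(1)[of k] x(2)[of k] by (simp add: inS tangency_variety_def)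
      then obtain r y where r: "strict_mono r" "y \<in> coord_space I" "(\<lambda>k. sub_vec I (f (x (r k)))) \<longlonglongrightarrow> y"
        using subseq by blast
      have "filterlim (\<lambda>k. norm (x (r k))) at_top sequentially"
        using norm_top[OF x(3)] filterlim_subseq[OF r(1)] by (rule filterlim_compose)
      then have "y \<in> tangency_values f K I ?c"
        using r x(1,2) unfolding tangency_values_def by (auto intro!: exI[of _ "\<lambda>k. x (r k)"])
      then show False using p by (simp add: M_tame_def)
    qed
  next
    assume "bounded ?S"
    then show "M_tame f K I ?c"
      unfolding M_tame_def tangency_values_def using no_seq inS
      by (auto simp: tangency_variety_def)
  qed
  have wPS_PS: "weak_PS_values f K I ?c \<subseteq> PS_values f K I ?c"
  proof
    fix y assume "y \<in> weak_PS_values f K I ?c"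
    then obtain x where y: "y \<in> coord_space I" "\<forall>k. x k \<in> K \<and> f (x k) \<le> ?c"
      "filterlim (\<lambda>k. norm (x k)) at_top sequentially" "(\<lambda>k. sub_vec I (f (x k))) \<longlonglongrightarrow> y"
      and l: "(\<lambda>k. norm (x k) * rabier f K (x k)) \<longlonglongrightarrow> 0"
      unfolding weak_PS_values_def by blast
    \<comment> \<open>The factor \<open>inverse (norm (x k))\<close> tends to 0 and cancels the norm
      as soon as the latter is positive.\<close>
    have "(\<lambda>k. norm (x k) * rabier f K (x k) * inverse (norm (x k))) \<longlonglongrightarrow> 0 * 0"
      by (intro tendsto_mult l tendsto_inverse_0_at_top y)
    moreover have "\<forall>\<^sub>F k in sequentially. 0 < norm (x k)" using y(3) unfolding filterlim_at_top_dense by blast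
    then have "\<forall>\<^sub>F k in sequentially. norm (x k) * rabier f K (x k) * inverse (norm (x k)) = rabier f K (x k)"
      by eventually_elim simp
    ultimately have "(\<lambda>k. rabier f K (x k)) \<longlonglongrightarrow> 0"
      by (simp add: tendsto_cong)
    then show "y \<in> PS_values f K I ?c" using y unfolding PS_values_def by blast
  qed
  have weak: "bounded ?S" if p: "weak_palais_smale f K I ?c"
  proof (rule ccontr)
    assume nb: "\<not> bounded ?S"
    \<comment> \<open>One index of I is enough: the maximum dominates that component, which is
      bounded below on the sublevel set.\<close>
    obtain i where i: "i \<in> I" using assms(4) by blast
    have low: "b $ i - ?c $ i \<le> vmax (f x - ?c)" if "x \<in> K" "f x \<le> ?c" for x
      using b[of x i] i that vmax_ge[of "f x - ?c" i] by (simp add: inS)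
    have unb': "\<exists>x\<in>K. f x \<le> ?c \<and> R \<le> norm x" for R using unb[OF nb] inS by blast
    have "\<exists>x\<in>K. f x \<le> ?c \<and> real k \<le> norm x \<and> 0 \<le> rabier f K x \<and>
        norm x * rabier f K x \<le> inverse (real (Suc k))" for k
      by (rule exists_almost_critical[OF f K unb' low]) simp_all
    then obtain x where x: "\<And>k. x k \<in> K" "\<And>k. f (x k) \<le> ?c" "\<And>k. real k \<le> norm (x k)"
      "\<And>k. 0 \<le> rabier f K (x k)" "\<And>k. norm (x k) * rabier f K (x k) \<le> inverse (real (Suc k))" by metis
    have "x k \<in> ?S" for k using x by (simp add: inS)
    then obtain r y where r: "strict_mono r" "y \<in> coord_space I" "(\<lambda>k. sub_vec I (f (x (r k)))) \<longlonglongrightarrow> y"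
      using subseq by blast
    have "(\<lambda>k. norm (x k) * rabier f K (x k)) \<longlonglongrightarrow> 0"
      by (rule tendsto_sandwich[OF _ _ tendsto_const LIMSEQ_inverse_real_of_nat]) (use x in auto)
    then have "(\<lambda>k. norm (x (r k)) * rabier f K (x (r k))) \<longlonglongrightarrow> 0"
      using filterlim_subseq[OF r(1)] by (rule filterlim_compose)
    moreover have "filterlim (\<lambda>k. norm (x (r k))) at_top sequentially"
      using norm_top[OF x(3)] filterlim_subseq[OF r(1)] by (rule filterlim_compose)
    ultimately have "y \<in> weak_PS_values f K I ?c"
      using r x(1,2) unfolding weak_PS_values_def by (auto intro!: exI[of _ "\<lambda>k. x (r k)"])
    then show False using p by (simp add: weak_palais_smale_def)
  qed
  have PS: "palais_smale f K I ?c" if "bounded ?S"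
    unfolding palais_smale_def PS_values_def using no_seq[OF that] inS by auto
  have PS_wPS: "weak_palais_smale f K I ?c" if "palais_smale f K I ?c"
    using wPS_PS that by (simp add: palais_smale_def weak_palais_smale_def)
  have "compact ?S \<and> compact (section_at (f ` K) ?c)" if "bounded ?S"
  proof -
    have cS: "compact ?S" using that closedS by (simp add: compact_eq_bounded_closed)
    have "y \<in> {?c - r | r. 0 \<le> r} \<longleftrightarrow> y \<le> ?c" for y
      by (auto simp: less_eq_vec_def intro!: exI[of _ "?c - y"])
    then have "section_at (f ` K) ?c = f ` ?S" unfolding section_at_def sublevel_set_def by blast
    then show ?thesis
      using cS by (simp add: compact_continuous_image locally_lipschitz_continuous_on[OF f])
  qed
  \<comment> \<open>Boundedness, the Palais-Smale and the weak Palais-Smale condition form a cycle;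
    properness and M-tameness are each equivalent to boundedness.\<close>
  then show ?thesis using proper M weak PS PS_wPS by blast
qed

end
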